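(* Let $G$ be a finitely generated virtually abelian group. There exists a finite inverse-closed generating set $Z$ for $G$ such that $\mathsf{ConjGeo}(G,Z)$ is piecewise testable. Furthermore, there is a total ordering of $Z$ with respect to which $G$ is shortlex automatic and $\mathsf{ConjMinLenSL}(G,Z)$ is regular.
   Context: For $w\in Z^*$, $l(w)$ is its length and $\pi(w)$ the element of $G$ it represents. For $g\in G$, $|g|$ is the length of a shortest word over $Z$ representing $g$, and $|g|_c=\min\{|h| : h\text{ conjugate to }g\text{ in }G\}$. $\mathsf{ConjGeo}(G,Z)=\{w\in Z^* : l(w)=|\pi(w)|_c\}$. Given a total ordering of $Z$, the shortlex ordering on $Z^*$ compares words first by length and then, for equal length, lexicographically; $y_g$ denotes the shortlex least word representing $g$; $\mathsf{SL}(G,Z)=\{y_g : g\in G\}$ and $\mathsf{ConjMinLenSL}(G,Z)=\{y_g : g\in G,\ |g|=|g|_c\}$. $G$ is shortlex automatic with respect to the ordered generating set $Z$ if $\mathsf{SL}(G,Z)$ is the language of an automatic structure for $G$. A language $L\subseteq A^*$ over a finite alphabet $A$ is piecewise testable if it is defined by a regular expression combining terms of the form $A^*a_1A^*a_2\cdots A^*a_kA^*$ (with $k\ge 0$ and $a_i\in A$) using the Boolean operations of union, intersection and complementation. A language is regular if it is accepted by a finite state automaton. *)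

theory Defs
  imports "HOL-Algebra.Coset" "HOL-Algebra.Generated_Groups" "HOL-Library.Sublist"
begin

section \<open>Regular and piecewise testable languages\<close>

text \<open>
  Complete deterministic automata. Taking the states to be natural numbers is no restriction,
  since the state set is finite.
\<close>

definition regular_language :: "'a set \<Rightarrow> 'a list set \<Rightarrow> bool" where
  "regular_language A L \<longleftrightarrow> finite A \<and>
     (\<exists>(Q :: nat set) q0 \<delta> F. finite Q \<and> q0 \<in> Q \<and> F \<subseteq> Q \<and>
        (\<forall>q\<in>Q. \<forall>a\<in>A. \<delta> q a \<in> Q) \<and>
        L = {w \<in> lists A. foldl \<delta> q0 w \<in> F})"

text \<open>The language \<open>A\<^sup>* a\<^sub>1 A\<^sup>* a\<^sub>2 \<dots> A\<^sup>* a\<^sub>k A\<^sup>*\<close>.\<close>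

fun scattered :: "'a set \<Rightarrow> 'a list \<Rightarrow> 'a list set" where
  "scattered A [] = lists A"
| "scattered A (a # as) = {u @ a # v | u v. u \<in> lists A \<and> v \<in> scattered A as}"

lemma scattered_eq_subseq:
  "as \<in> lists A \<Longrightarrow> scattered A as = {w \<in> lists A. subseq as w}"
proof (induction as)
  case Nil
  then show ?case by simp
next
  case (Cons a as)
  then have a: "a \<in> A" and IH: "scattered A as = {w \<in> lists A. subseq as w}"
    by simp_all
  show ?case
  proof (intro Set.set_eqI iffI)
    fix w assume "w \<in> scattered A (a # as)"
    then obtain u v where "w = u @ a # v" "u \<in> lists A" "v \<in> lists A" "subseq as v"
      unfolding scattered.simps IH by blast
    then show "w \<in> {w \<in> lists A. subseq (a # as) w}"
      using a by (simp add: list_emb_append2)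
  next
    fix w assume "w \<in> {w \<in> lists A. subseq (a # as) w}"
    then have w: "w \<in> lists A" and "subseq (a # as) w"
      by simp_all
    then obtain u v where "w = u @ a # v" "subseq as v"
      using list_emb_ConsD by fast
    then show "w \<in> scattered A (a # as)"
      unfolding scattered.simps IH using w by auto
  qed
qed

inductive piecewise_testable :: "'a set \<Rightarrow> 'a list set \<Rightarrow> bool" for A where
  basic: "as \<in> lists A \<Longrightarrow> piecewise_testable A (scattered A as)"
| union: "piecewise_testable A L \<Longrightarrow> piecewise_testable A M \<Longrightarrow> piecewise_testable A (L \<union> M)"
| inter: "piecewise_testable A L \<Longrightarrow> piecewise_testable A M \<Longrightarrow> piecewise_testable A (L \<inter> M)"
| compl: "piecewise_testable A L \<Longrightarrow> piecewise_testable A (lists A - L)"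


section \<open>Groups and generating sets\<close>

definition finitely_generated :: "('a, 'b) monoid_scheme \<Rightarrow> bool" where
  "finitely_generated G \<longleftrightarrow> (\<exists>S. finite S \<and> S \<subseteq> carrier G \<and> generate G S = carrier G)"

definition virtually_abelian :: "('a, 'b) monoid_scheme \<Rightarrow> bool" where
  "virtually_abelian G \<longleftrightarrow>
     (\<exists>H. subgroup H G \<and> finite (rcosets\<^bsub>G\<^esub> H) \<and> comm_group (G\<lparr>carrier := H\<rparr>))"

definition finite_inverse_closed_generating_set ::
    "('a, 'b) monoid_scheme \<Rightarrow> 'a set \<Rightarrow> bool" where
  "finite_inverse_closed_generating_set G Z \<longleftrightarrow>
     finite Z \<and> Z \<subseteq> carrier G \<and> (\<forall>z\<in>Z. inv\<^bsub>G\<^esub> z \<in> Z) \<and> generate G Z = carrier G"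

definition conjugate_in :: "('a, 'b) monoid_scheme \<Rightarrow> 'a \<Rightarrow> 'a \<Rightarrow> bool" where
  "conjugate_in G h g \<longleftrightarrow> (\<exists>x\<in>carrier G. h = inv\<^bsub>G\<^esub> x \<otimes>\<^bsub>G\<^esub> g \<otimes>\<^bsub>G\<^esub> x)"


section \<open>Words and lengths\<close>

text \<open>The element \<open>\<pi>(w)\<close> represented by \<open>w\<close>.\<close>

definition word_value :: "('a, 'b) monoid_scheme \<Rightarrow> 'a list \<Rightarrow> 'a" where
  "word_value G w = foldr (\<otimes>\<^bsub>G\<^esub>) w \<one>\<^bsub>G\<^esub>"

definition representatives :: "('a, 'b) monoid_scheme \<Rightarrow> 'a set \<Rightarrow> 'a \<Rightarrow> 'a list set" where
  "representatives G Z g = {w \<in> lists Z. word_value G w = g}"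

definition group_length :: "('a, 'b) monoid_scheme \<Rightarrow> 'a set \<Rightarrow> 'a \<Rightarrow> nat" where
  "group_length G Z g = (LEAST n. \<exists>w\<in>representatives G Z g. length w = n)"

definition conj_length :: "('a, 'b) monoid_scheme \<Rightarrow> 'a set \<Rightarrow> 'a \<Rightarrow> nat" where
  "conj_length G Z g = (LEAST n. \<exists>h. conjugate_in G h g \<and> group_length G Z h = n)"

definition ConjGeo :: "('a, 'b) monoid_scheme \<Rightarrow> 'a set \<Rightarrow> 'a list set" where
  "ConjGeo G Z = {w \<in> lists Z. length w = conj_length G Z (word_value G w)}"


section \<open>Shortlex normal forms\<close>

text \<open>
  An ordering of \<open>Z\<close> is a reflexive relation \<open>r\<close> with \<open>linear_order_on Z r\<close>, whereas
  \<^const>\<open>lenlex\<close> expects a strict relation on the letters.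
\<close>

definition shortlex :: "'a rel \<Rightarrow> 'a list rel" where
  "shortlex r = lenlex (r - Id)"

definition shortlex_rep :: "('a, 'b) monoid_scheme \<Rightarrow> 'a set \<Rightarrow> 'a rel \<Rightarrow> 'a \<Rightarrow> 'a list" where
  "shortlex_rep G Z r g =
     (THE w. w \<in> representatives G Z g \<and>
             (\<forall>v\<in>representatives G Z g. v \<noteq> w \<longrightarrow> (w, v) \<in> shortlex r))"

definition SL :: "('a, 'b) monoid_scheme \<Rightarrow> 'a set \<Rightarrow> 'a rel \<Rightarrow> 'a list set" where
  "SL G Z r = {shortlex_rep G Z r g | g. g \<in> carrier G}"

definition ConjMinLenSL :: "('a, 'b) monoid_scheme \<Rightarrow> 'a set \<Rightarrow> 'a rel \<Rightarrow> 'a list set" where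
  "ConjMinLenSL G Z r =
     {shortlex_rep G Z r g | g. g \<in> carrier G \<and> group_length G Z g = conj_length G Z g}"


section \<open>Automatic structures\<close>

text \<open>A pair of words as one word over pairs, the shorter being padded at its end by \<^const>\<open>None\<close>.\<close>

fun padded_pair :: "'a list \<Rightarrow> 'a list \<Rightarrow> ('a option \<times> 'a option) list" where
  "padded_pair [] [] = []"
| "padded_pair (a # u) [] = (Some a, None) # padded_pair u []"
| "padded_pair [] (b # v) = (None, Some b) # padded_pair [] v"
| "padded_pair (a # u) (b # v) = (Some a, Some b) # padded_pair u v"

definition padded_alphabet :: "'a set \<Rightarrow> ('a option \<times> 'a option) set" where
  "padded_alphabet A =
     (insert None (Some ` A) \<times> insert None (Some ` A)) - {(None, None)}"

text \<open>
  \<open>L\<close> is the language of an automatic structure: a word acceptor for \<open>L\<close> exists, and so do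
  the multiplier automata for every generator and (the case \<open>x = \<one>\<close>) for equality.
\<close>

definition automatic_structure_language ::
    "('a, 'b) monoid_scheme \<Rightarrow> 'a set \<Rightarrow> 'a list set \<Rightarrow> bool" where
  "automatic_structure_language G Z L \<longleftrightarrow>
     regular_language Z L \<and> word_value G ` L = carrier G \<and>
     (\<forall>x \<in> insert \<one>\<^bsub>G\<^esub> Z.
        regular_language (padded_alphabet Z)
          {padded_pair u v | u v. u \<in> L \<and> v \<in> L \<and>
             word_value G u \<otimes>\<^bsub>G\<^esub> x = word_value G v})"

definition shortlex_automatic ::
    "('a, 'b) monoid_scheme \<Rightarrow> 'a set \<Rightarrow> 'a rel \<Rightarrow> bool" where
  "shortlex_automatic G Z r \<longleftrightarrow> automatic_structure_language G Z (SL G Z r)"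

end

theory Submission
  imports Defs "HOL-Library.Multiset" "HOL-Library.Infinite_Set"
begin

text \<open>
  Let \<open>N\<close> be an abelian normal subgroup of finite index. Take \<open>Y\<close> to consist of generators of \<open>G\<close>, of
  representatives modulo \<open>N\<close>, and of their inverses, and \<open>X \<subseteq> N\<close> to be the conjugates of the finitely
  many elements of \<open>N\<close> that relate products of two or three letters of \<open>Y\<close> to representatives. In
  \<open>Z = X \<union> Y\<close>, geodesics contain at most two letters outside \<open>X\<close>. Deleting a letter of \<open>X\<close> multiplies
  the value by a conjugate of a letter, so words of \<open>ConjGeo\<close> remain in \<open>ConjGeo\<close>; and a language
  with this closure property and a bounded number of letters outside \<open>X\<close> is piecewise testable by
  Higman's lemma.

  If the letters of \<open>X\<close> precede the others, shortlex normal forms are sorted and have the same closure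
  property, so \<open>SL\<close> and \<open>ConjMinLenSL = SL \<inter> ConjGeo\<close> are piecewise testable as well. The multiplier
  languages are regular because only finitely many word differences occur: otherwise Higman's lemma
  yields two solutions of the multiplier equation with distinct differences such that the second
  extends the first by letters of \<open>X\<close>, and uniqueness of normal forms makes the inserted letters on
  both sides agree.
\<close>


section \<open>Well-quasi-orders and Higman's lemma\<close>

text \<open>
  The chain form of well-quasi-orders, rather than the one asking for a single good pair, since it
  is evidently closed under conjunction.
\<close>

definition wqo_set :: "('a \<Rightarrow> 'a \<Rightarrow> bool) \<Rightarrow> 'a set \<Rightarrow> bool" where
  "wqo_set P S \<longleftrightarrow> (\<forall>f::nat \<Rightarrow> 'a. range f \<subseteq> S \<longrightarrow>
     (\<exists>\<phi>::nat \<Rightarrow> nat. strict_mono \<phi> \<and> (\<forall>i j. i < j \<longrightarrow> P (f (\<phi> i)) (f (\<phi> j)))))"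

lemma wqo_setD:
  assumes "wqo_set P S" "\<And>n::nat. f n \<in> S"
  obtains \<phi> :: "nat \<Rightarrow> nat" where "strict_mono \<phi>" "\<And>i j. i < j \<Longrightarrow> P (f (\<phi> i)) (f (\<phi> j))"
proof -
  have "range f \<subseteq> S" using assms(2) by auto
  then show thesis using assms(1) that unfolding wqo_set_def by blast
qed

lemma wqo_setI:
  assumes "\<And>f::nat \<Rightarrow> 'a. (\<And>n. f n \<in> S) \<Longrightarrow>
    \<exists>\<phi>::nat \<Rightarrow> nat. strict_mono \<phi> \<and> (\<forall>i j. i < j \<longrightarrow> P (f (\<phi> i)) (f (\<phi> j)))"
  shows "wqo_set P S"
  unfolding wqo_set_def using assms by (simp add: image_subset_iff)

lemma infinite_subsequence:
  assumes "infinite (I :: nat set)"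
  obtains \<phi> :: "nat \<Rightarrow> nat" where "strict_mono \<phi>" "\<And>n. \<phi> n \<in> I"
  using assms strict_mono_enumerate enumerate_in_set by metis

lemma wqo_set_mono:
  assumes "wqo_set P S" "T \<subseteq> S" "\<And>x y. x \<in> T \<Longrightarrow> y \<in> T \<Longrightarrow> P x y \<Longrightarrow> Q x y"
  shows "wqo_set Q T"
proof (rule wqo_setI)
  fix f :: "nat \<Rightarrow> 'a" assume f: "\<And>n. f n \<in> T"
  then obtain \<phi> :: "nat \<Rightarrow> nat" where "strict_mono \<phi>" "\<And>i j. i < j \<Longrightarrow> P (f (\<phi> i)) (f (\<phi> j))"
    using assms(1,2) wqo_setD[of P S f] by (metis subsetD)
  then show "\<exists>\<phi>::nat \<Rightarrow> nat. strict_mono \<phi> \<and> (\<forall>i j. i < j \<longrightarrow> Q (f (\<phi> i)) (f (\<phi> j)))"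
    using f assms(3) by blast
qed

text \<open>A chain for \<open>P\<close> is thinned out to a chain for \<open>Q\<close>; the first
  relation survives because it holds between any two members of its chain, not only between
  neighbours.\<close>

lemma wqo_set_conj:
  assumes "wqo_set P S" "wqo_set Q S"
  shows "wqo_set (\<lambda>x y. P x y \<and> Q x y) S"
proof (rule wqo_setI)
  fix f :: "nat \<Rightarrow> 'a" assume f: "\<And>n. f n \<in> S"
  obtain \<phi> :: "nat \<Rightarrow> nat" where \<phi>: "strict_mono \<phi>" "\<And>i j. i < j \<Longrightarrow> P (f (\<phi> i)) (f (\<phi> j))"
    using wqo_setD[OF assms(1), of f] f by blast
  obtain \<psi> :: "nat \<Rightarrow> nat" where \<psi>: "strict_mono \<psi>"
      "\<And>i j. i < j \<Longrightarrow> Q (f (\<phi> (\<psi> i))) (f (\<phi> (\<psi> j)))"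
    using wqo_setD[OF assms(2), of "\<lambda>n. f (\<phi> n)"] f by blast
  have "strict_mono (\<phi> \<circ> \<psi>)" using \<phi> \<psi> by (simp add: strict_mono_def)
  then show "\<exists>\<phi>::nat \<Rightarrow> nat. strict_mono \<phi> \<and> (\<forall>i j. i < j \<longrightarrow> P (f (\<phi> i)) (f (\<phi> j)) \<and> Q (f (\<phi> i)) (f (\<phi> j)))"
    using \<phi> \<psi> by (intro exI[of _ "\<phi> \<circ> \<psi>"]) (auto simp: strict_mono_less)
qed

lemma wqo_set_vimage:
  assumes "wqo_set P T" "\<And>x. x \<in> S \<Longrightarrow> h x \<in> T"
  shows "wqo_set (\<lambda>x y. P (h x) (h y)) S"
proof (rule wqo_setI)
  fix f :: "nat \<Rightarrow> 'b" assume f: "\<And>n. f n \<in> S"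
  show "\<exists>\<phi>::nat \<Rightarrow> nat. strict_mono \<phi> \<and> (\<forall>i j. i < j \<longrightarrow> P (h (f (\<phi> i))) (h (f (\<phi> j))))"
    using wqo_setD[OF assms(1), of "\<lambda>n. h (f n)"] f assms(2) by metis
qed

text \<open>One of the two sets receives infinitely many terms of the sequence, and the chain is
  sought among these.\<close>

lemma wqo_set_union:
  assumes "wqo_set P S" "wqo_set P T"
  shows "wqo_set P (S \<union> T)"
proof (rule wqo_setI)
  fix f :: "nat \<Rightarrow> 'a" assume f: "\<And>n. f n \<in> S \<union> T"
  have sub: "\<exists>\<phi>::nat \<Rightarrow> nat. strict_mono \<phi> \<and> (\<forall>i j. i < j \<longrightarrow> P (f (\<phi> i)) (f (\<phi> j)))"
    if I: "infinite {n. f n \<in> U}" and U: "wqo_set P U" for U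
  proof -
    obtain \<phi> :: "nat \<Rightarrow> nat" where \<phi>: "strict_mono \<phi>" "\<And>n. \<phi> n \<in> {n. f n \<in> U}"
      using infinite_subsequence[OF I] by blast
    obtain \<psi> :: "nat \<Rightarrow> nat" where \<psi>: "strict_mono \<psi>"
      "\<And>i j. i < j \<Longrightarrow> P (f (\<phi> (\<psi> i))) (f (\<phi> (\<psi> j)))"
      using wqo_setD[OF U, of "\<lambda>n. f (\<phi> n)"] \<phi> by blast
    have "strict_mono (\<phi> \<circ> \<psi>)" using \<phi> \<psi> by (simp add: strict_mono_def)
    then show ?thesis using \<psi> by (intro exI[of _ "\<phi> \<circ> \<psi>"]) auto
  qed
  have "{n. f n \<in> S} \<union> {n. f n \<in> T} = UNIV" using f by auto
  then have "infinite {n. f n \<in> S} \<or> infinite {n. f n \<in> T}"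
    by (metis finite_UnI infinite_UNIV_nat)
  then show "\<exists>\<phi>::nat \<Rightarrow> nat. strict_mono \<phi> \<and> (\<forall>i j. i < j \<longrightarrow> P (f (\<phi> i)) (f (\<phi> j)))"
    using sub assms by blast
qed

lemma wqo_set_eq_finite:
  assumes "finite S"
  shows "wqo_set (=) S"
proof (rule wqo_setI)
  fix f :: "nat \<Rightarrow> 'a" assume f: "\<And>n. f n \<in> S"
  then have "finite (range f)" using assms by (meson finite_subset image_subsetI)
  then obtain n where "infinite {m. f m = f n}"
    using pigeonhole_infinite[of UNIV f] by auto
  then obtain \<phi> :: "nat \<Rightarrow> nat" where "strict_mono \<phi>" "\<And>m. \<phi> m \<in> {m. f m = f n}"
    using infinite_subsequence by blast
  then show "\<exists>\<phi>::nat \<Rightarrow> nat. strict_mono \<phi> \<and> (\<forall>i j. i < j \<longrightarrow> f (\<phi> i) = f (\<phi> j))"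
    by auto
qed

text \<open>
  A word avoiding \<open>a # w\<close> either avoids the letter \<open>a\<close>, or factors at its first \<open>a\<close> into a word
  over a smaller alphabet and a word avoiding \<open>w\<close>; this gives an induction which needs no minimal
  bad sequence.
\<close>

lemma higman_avoiding:
  assumes smaller: "\<And>a. a \<in> A \<Longrightarrow> wqo_set subseq (lists (A - {a}))"
    and "w \<in> lists A"
  shows "wqo_set subseq {v \<in> lists A. \<not> subseq w v}"
  using assms(2)
proof (induction w)
  case Nil
  then show ?case by (simp add: wqo_set_def)
next
  case (Cons a w)
  then have a: "a \<in> A" and IH: "wqo_set subseq {v \<in> lists A. \<not> subseq w v}" by auto
  define S where "S = {v \<in> lists A. \<not> subseq (a # w) v \<and> a \<in> set v}"
  define pre where "pre = takeWhile (\<lambda>b. b \<noteq> a)"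
  define post where "post v = tl (dropWhile (\<lambda>b. b \<noteq> a) v)" for v
  have split: "v = pre v @ a # post v" if "v \<in> S" for v
  proof -
    have "dropWhile (\<lambda>b. b \<noteq> a) v \<noteq> []" using that by (auto simp: S_def dropWhile_eq_Nil_conv)
    then have "dropWhile (\<lambda>b. b \<noteq> a) v = a # post v"
      unfolding post_def using hd_dropWhile[of "\<lambda>b. b \<noteq> a" v] by (cases "dropWhile (\<lambda>b. b \<noteq> a) v") auto
    then show ?thesis unfolding pre_def using takeWhile_dropWhile_id[of "\<lambda>b. b \<noteq> a" v] by simp
  qed
  have pre: "pre v \<in> lists (A - {a})" if "v \<in> S" for v
    using that unfolding S_def pre_def by (auto dest: set_takeWhileD)
  have post: "post v \<in> {v \<in> lists A. \<not> subseq w v}" if v: "v \<in> S" for v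
  proof -
    have "subseq (a # w) v" if "subseq w (post v)"
      by (subst split[OF v]) (use that in \<open>simp add: list_emb_append2\<close>)
    moreover have "set (post v) \<subseteq> set v" by (subst (2) split[OF v]) auto
    ultimately show ?thesis using v unfolding S_def by auto
  qed
  have "wqo_set (\<lambda>v v'. subseq (pre v) (pre v') \<and> subseq (post v) (post v')) S"
    using wqo_set_conj[OF wqo_set_vimage[OF smaller[OF a] pre] wqo_set_vimage[OF IH post]] .
  then have "wqo_set subseq S"
  proof (rule wqo_set_mono)
    fix v v' assume "v \<in> S" "v' \<in> S" and "subseq (pre v) (pre v') \<and> subseq (post v) (post v')"
    then show "subseq v v'"
      using split[of v] split[of v'] by (metis list_emb_append_mono subseq_Cons2)
  qed simp
  then have "wqo_set subseq (lists (A - {a}) \<union> S)"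
    using wqo_set_union smaller[OF a] by blast
  then show ?case
    by (rule wqo_set_mono) (auto simp: S_def)
qed

text \<open>Induction on the alphabet: \<open>higman_avoiding\<close> turns the claim for all
  smaller alphabets into the claim for words avoiding one fixed word.\<close>

lemma higman:
  assumes "finite A"
  shows "wqo_set subseq (lists A)"
  using assms
proof (induction A rule: finite_psubset_induct)
  case (psubset A)
  have avoiding: "wqo_set subseq {v \<in> lists A. \<not> subseq w v}" if "w \<in> lists A" for w
    using that by (intro higman_avoiding psubset.IH) auto
  show ?case
  proof (rule wqo_setI)
    fix f :: "nat \<Rightarrow> 'a list" assume f: "\<And>n. f n \<in> lists A"
    show "\<exists>\<phi>::nat \<Rightarrow> nat. strict_mono \<phi> \<and> (\<forall>i j. i < j \<longrightarrow> subseq (f (\<phi> i)) (f (\<phi> j)))"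
    \<comment> \<open>Either infinitely many terms avoid a single term \<open>f i\<close>, and
      \<open>avoiding\<close> provides the chain, or each term embeds into all but finitely many
      others, and a chain is built greedily.\<close>
    proof (cases "\<exists>i. infinite {j. \<not> subseq (f i) (f j)}")
      case True
      then obtain i where "infinite {j. \<not> subseq (f i) (f j)}" by blast
      then obtain \<phi> :: "nat \<Rightarrow> nat" where \<phi>: "strict_mono \<phi>" "\<And>n. \<phi> n \<in> {j. \<not> subseq (f i) (f j)}"
        using infinite_subsequence by blast
      obtain \<psi> :: "nat \<Rightarrow> nat" where \<psi>: "strict_mono \<psi>"
        "\<And>i j. i < j \<Longrightarrow> subseq (f (\<phi> (\<psi> i))) (f (\<phi> (\<psi> j)))"
        using wqo_setD[OF avoiding[OF f[of i]], of "\<lambda>n. f (\<phi> n)"] \<phi> f by blast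
      have "strict_mono (\<phi> \<circ> \<psi>)" using \<phi> \<psi> by (simp add: strict_mono_def)
      then show ?thesis using \<psi> by (intro exI[of _ "\<phi> \<circ> \<psi>"]) auto
    next
      case False
      have "\<exists>y. x < y \<and> subseq (f x) (f y)" for x
      proof -
        have "infinite (- ({j. \<not> subseq (f x) (f j)} \<union> {..x}))"
          using False by (simp add: Compl_eq_Diff_UNIV)
        then obtain y where "y \<in> - ({j. \<not> subseq (f x) (f j)} \<union> {..x})"
          using infinite_imp_nonempty by blast
        then show ?thesis by auto
      qed
      then obtain \<phi> :: "nat \<Rightarrow> nat" where \<phi>: "\<And>n. \<phi> n < \<phi> (Suc n) \<and> subseq (f (\<phi> n)) (f (\<phi> (Suc n)))"
        using dependent_nat_choice[of "\<lambda>_ _. True" "\<lambda>_ x y. x < y \<and> subseq (f x) (f y)"] by auto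
      have "subseq (f (\<phi> i)) (f (\<phi> j))" if "i \<le> j" for i j
        using that by (induction j rule: dec_induct) (use \<phi> in \<open>auto intro: subseq_order.order_trans\<close>)
      moreover have "strict_mono \<phi>" using \<phi> by (simp add: strict_mono_Suc_iff)
      ultimately show ?thesis by auto
    qed
  qed
qed

text \<open>The basis consists of the minimal words of \<open>B\<close>. By Higman's lemma
  infinitely many of them would include two comparable ones, against minimality; descent on the
  length finds a minimal word below each word of \<open>B\<close>.\<close>

lemma finite_subseq_basis:
  assumes "finite A" "B \<subseteq> lists A"
  obtains M where "finite M" "M \<subseteq> B" "\<And>b. b \<in> B \<Longrightarrow> \<exists>m\<in>M. subseq m b"
proof
  let ?M = "{m \<in> B. \<forall>m'\<in>B. subseq m' m \<longrightarrow> m' = m}"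
  show "finite ?M"
  proof (rule ccontr)
    assume "infinite ?M"
    then obtain f :: "nat \<Rightarrow> 'a list" where f: "inj f" "range f \<subseteq> ?M"
      using infinite_countable_subset by blast
    then have "\<And>n. f n \<in> lists A" using assms(2) by blast
    then obtain \<phi> :: "nat \<Rightarrow> nat" where \<phi>: "strict_mono \<phi>"
      "\<And>i j. i < j \<Longrightarrow> subseq (f (\<phi> i)) (f (\<phi> j))"
      using wqo_setD[OF higman[OF assms(1)], of f] by blast
    then have "f (\<phi> 0) = f (\<phi> 1)" using f(2) by (simp add: image_subset_iff)
    then show False using f(1) \<phi>(1) by (metis injD strict_mono_eq zero_neq_one)
  qed
  show "\<exists>m\<in>?M. subseq m b" if "b \<in> B" for b
    using that
  proof (induction b rule: length_induct)
    case (1 b)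
    show ?case
    proof (cases "b \<in> ?M")
      case False
      then obtain m' where m': "m' \<in> B" "subseq m' b" "m' \<noteq> b" using 1 by auto
      then have "length m' < length b"
        by (metis list_emb_length le_neq_implies_less subseq_same_length)
      then show ?thesis using 1 m' subseq_order.order_trans by meson
    qed auto
  qed
qed auto


section \<open>Regular and piecewise testable languages\<close>

text \<open>The left quotient, or residual, of a language by a prefix. The distinct quotients serve
  as states of an automaton.\<close>

definition quot :: "'a list set \<Rightarrow> 'a list \<Rightarrow> 'a list set" where
  "quot L w = {v. w @ v \<in> L}"

text \<open>The Myhill-Nerode theorem. It reduces regularity to a finiteness statement, so that
  later proofs only count quotients and construct no automata.\<close>

lemma myhill_nerode:
  "regular_language A L \<longleftrightarrow> finite A \<and> L \<subseteq> lists A \<and> finite (range (quot L))"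
proof safe
  assume reg: "regular_language A L"
  then obtain Q :: "nat set" and q0 \<delta> F where
    Q: "finite Q" "q0 \<in> Q" "\<And>q a. q \<in> Q \<Longrightarrow> a \<in> A \<Longrightarrow> \<delta> q a \<in> Q"
    and L: "L = {w \<in> lists A. foldl \<delta> q0 w \<in> F}"
    unfolding regular_language_def by blast
  have closed: "foldl \<delta> q w \<in> Q" if "q \<in> Q" "w \<in> lists A" for q w
    using that by (induction w arbitrary: q) (auto intro: Q)
  \<comment> \<open>Here \<open>w\<close> may contain letters outside \<open>A\<close>; such words
    contribute the empty quotient.\<close>
  have "quot L w \<in> insert {} ((\<lambda>q. {v \<in> lists A. foldl \<delta> q v \<in> F}) ` Q)" for w
  proof (cases "w \<in> lists A")
    case True
    then have "quot L w = {v \<in> lists A. foldl \<delta> (foldl \<delta> q0 w) v \<in> F}"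
      unfolding quot_def L by auto
    then show ?thesis using closed[OF Q(2) True] by blast
  next
    case False
    then show ?thesis unfolding quot_def L by auto
  qed
  then show "finite (range (quot L))"
    using Q(1) by (meson finite.insertI finite_imageI finite_subset image_subsetI)
  show "finite A" using reg by (simp add: regular_language_def)
  show "\<And>w a. w \<in> L \<Longrightarrow> a \<in> set w \<Longrightarrow> a \<in> A" using L by auto
next
  assume A: "finite A" "L \<subseteq> lists A" and fin: "finite (range (quot L))"
  \<comment> \<open>Automaton states have to be natural numbers, so \<open>h\<close> numbers the
    quotients and \<open>g\<close> decodes the numbers.\<close>
  obtain h :: "'a list set \<Rightarrow> nat" where h: "inj_on h (range (quot L))"
    using finite_imp_inj_to_nat_seg[OF fin] by blast
  define g where "g = inv_into (range (quot L)) h"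
  define \<delta> where "\<delta> q a = h (quot (g q) [a])" for q a
  have g: "g (h (quot L w)) = quot L w" for w
    unfolding g_def using h by simp
  have step: "\<delta> (h (quot L w)) a = h (quot L (w @ [a]))" for w a
    by (simp add: \<delta>_def g) (simp add: quot_def)
  have run: "foldl \<delta> (h (quot L w)) v = h (quot L (w @ v))" for w v
    by (induction v arbitrary: w) (auto simp: step)
  define F where "F = {q \<in> h ` range (quot L). [] \<in> g q}"
  have acc: "foldl \<delta> (h (quot L [])) w \<in> F \<longleftrightarrow> w \<in> L" for w
    unfolding run F_def by (auto simp: g) (auto simp: quot_def)
  have "L = {w \<in> lists A. foldl \<delta> (h (quot L [])) w \<in> F}"
    using A(2) by (auto simp only: acc mem_Collect_eq)
  moreover have "F \<subseteq> h ` range (quot L)" by (simp add: F_def)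
  moreover have "\<forall>q\<in>h ` range (quot L). \<forall>a\<in>A. \<delta> q a \<in> h ` range (quot L)" by (simp add: step)
  moreover have "finite (h ` range (quot L))" "h (quot L []) \<in> h ` range (quot L)"
    using fin by simp_all
  ultimately show "regular_language A L"
    unfolding regular_language_def using A(1) by blast
qed

lemma regular_language_union:
  assumes "regular_language A L" "regular_language A M"
  shows "regular_language A (L \<union> M)"
proof -
  have "quot (L \<union> M) w = (\<lambda>(P, Q). P \<union> Q) (quot L w, quot M w)" for w
    by (auto simp: quot_def)
  then have "range (quot (L \<union> M)) \<subseteq> (\<lambda>(P, Q). P \<union> Q) ` (range (quot L) \<times> range (quot M))"
    by blast
  moreover have "finite (range (quot L) \<times> range (quot M))"
    using assms unfolding myhill_nerode by simp
  ultimately have "finite (range (quot (L \<union> M)))"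
    using finite_surj by blast
  then show ?thesis using assms unfolding myhill_nerode by simp
qed

lemma regular_language_Compl:
  assumes "regular_language A L"
  shows "regular_language A (lists A - L)"
proof -
  have "quot (lists A - L) w \<in> insert {} ((\<lambda>P. lists A - P) ` range (quot L))" for w
  proof (cases "w \<in> lists A")
    case True
    then have "quot (lists A - L) w = lists A - quot L w" by (auto simp: quot_def)
    then show ?thesis by blast
  next
    case False
    then have "quot (lists A - L) w = {}" by (auto simp: quot_def)
    then show ?thesis by simp
  qed
  then have "range (quot (lists A - L)) \<subseteq> insert {} ((\<lambda>P. lists A - P) ` range (quot L))"
    by blast
  then have "finite (range (quot (lists A - L)))"
    using assms unfolding myhill_nerode
    by (meson finite.insertI finite_imageI finite_subset)
  then show ?thesis using assms unfolding myhill_nerode by simp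
qed

lemma regular_language_Int:
  assumes "regular_language A L" "regular_language A M"
  shows "regular_language A (L \<inter> M)"
proof -
  have "L \<inter> M = lists A - ((lists A - L) \<union> (lists A - M))"
    using assms by (auto simp: myhill_nerode)
  then show ?thesis
    using assms by (simp add: regular_language_Compl regular_language_union)
qed

text \<open>Reading a letter of \<open>A\<close> either matches the head of the pattern or leaves
  the pattern unchanged, so every quotient by a word over \<open>A\<close> belongs to a suffix of
  the pattern.\<close>

lemma regular_language_scattered:
  assumes "finite A" "as \<in> lists A"
  shows "regular_language A (scattered A as)"
proof -
  have "quot {w \<in> lists A. subseq as w} w \<in> insert {} ((\<lambda>k. {w \<in> lists A. subseq (drop k as) w}) ` {..length as})" for w
  proof (induction w arbitrary: as)
    case Nil
    have "quot {w \<in> lists A. subseq as w} [] = {w \<in> lists A. subseq (drop 0 as) w}"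
      by (auto simp: quot_def)
    then show ?case by blast
  next
    case (Cons b w)
    consider "b \<notin> A" | "b \<in> A" "\<And>as'. as \<noteq> b # as'" | as' where "b \<in> A" "as = b # as'"
      by metis
    then show ?case
    proof cases
      case 1
      then show ?thesis by (auto simp: quot_def)
    next
      case 2
      then have "quot {w \<in> lists A. subseq as w} (b # w) = quot {w \<in> lists A. subseq as w} w"
        by (cases as) (auto simp: quot_def)
      then show ?thesis using Cons.IH[of as] by simp
    next
      case 3
      then have "quot {w \<in> lists A. subseq as w} (b # w) = quot {w \<in> lists A. subseq as' w} w"
        by (auto simp: quot_def)
      moreover have "(\<lambda>k. {w \<in> lists A. subseq (drop k as') w}) ` {..length as'}
          \<subseteq> (\<lambda>k. {w \<in> lists A. subseq (drop k as) w}) ` {..length as}"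
      proof
        fix S assume "S \<in> (\<lambda>k. {w \<in> lists A. subseq (drop k as') w}) ` {..length as'}"
        then obtain k where "k \<le> length as'" "S = {w \<in> lists A. subseq (drop k as') w}" by auto
        then have "Suc k \<in> {..length as}" "S = {w \<in> lists A. subseq (drop (Suc k) as) w}"
          using 3 by auto
        then show "S \<in> (\<lambda>k. {w \<in> lists A. subseq (drop k as) w}) ` {..length as}" by blast
      qed
      ultimately show ?thesis using Cons.IH[of as'] by auto
    qed
  qed
  then have "range (quot {w \<in> lists A. subseq as w}) \<subseteq>
      insert {} ((\<lambda>k. {w \<in> lists A. subseq (drop k as) w}) ` {..length as})"
    by blast
  then have "finite (range (quot {w \<in> lists A. subseq as w}))"
    by (meson finite.insertI finite_atMost finite_imageI finite_subset)
  then show ?thesis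
    using assms by (auto simp: myhill_nerode scattered_eq_subseq)
qed

lemma piecewise_testable_imp_regular:
  assumes "piecewise_testable A L" "finite A"
  shows "regular_language A L"
  using assms
  by induction (simp_all add: regular_language_scattered regular_language_union
      regular_language_Int regular_language_Compl)

section \<open>Closure properties of piecewise testable languages and a criterion for
  membership\<close>

lemma piecewise_testable_subset: "piecewise_testable A L \<Longrightarrow> L \<subseteq> lists A"
proof (induction rule: piecewise_testable.induct)
  case (basic as)
  then show ?case by (simp add: scattered_eq_subseq)
qed auto

lemma piecewise_testable_empty: "piecewise_testable A {}"
proof -
  have "piecewise_testable A (lists A - scattered A [])"
    by (intro piecewise_testable.compl piecewise_testable.basic) simp
  then show ?thesis by simp
qed

lemma piecewise_testable_UN:
  assumes "finite I" "\<And>i. i \<in> I \<Longrightarrow> piecewise_testable A (L i)"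
  shows "piecewise_testable A (\<Union>i\<in>I. L i)"
  using assms
proof (induction I)
  case empty
  then show ?case by (simp add: piecewise_testable_empty)
next
  case (insert i I)
  then show ?case by (simp add: piecewise_testable.union)
qed

lemma piecewise_testable_Diff:
  assumes "piecewise_testable A L" "piecewise_testable A M"
  shows "piecewise_testable A (L - M)"
proof -
  have "L - M = L \<inter> (lists A - M)"
    using piecewise_testable_subset[OF assms(1)] by blast
  then show ?thesis by (simp add: assms piecewise_testable.compl piecewise_testable.inter)
qed

lemma piecewise_testable_up_closure:
  assumes "finite M" "M \<subseteq> lists A"
  shows "piecewise_testable A {w \<in> lists A. \<exists>m\<in>M. subseq m w}"
proof -
  have "{w \<in> lists A. \<exists>m\<in>M. subseq m w} = (\<Union>m\<in>M. scattered A m)"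
    using assms(2) by (auto simp: scattered_eq_subseq subset_iff)
  moreover have "piecewise_testable A \<dots>"
    using assms by (intro piecewise_testable_UN piecewise_testable.basic) auto
  ultimately show ?thesis by simp
qed

lemma finite_lists_bounded_length: "finite A \<Longrightarrow> finite {w \<in> lists A. length w \<le> n}"
  using finite_lists_length_le[of A n] by (simp add: lists_eq_set)

lemma subseq_length_ex:
  assumes "n \<le> length (v :: 'a list)"
  obtains u where "subseq u v" "length u = n"
proof
  show "subseq (take n v) v"
    using list_emb_append_mono[OF subseq_order.order_refl[of "take n v"] list_emb_Nil[of "(=)" "drop n v"]]
    by simp
qed (use assms in simp)

text \<open>The projection equals \<open>s\<close> exactly if \<open>s\<close> embeds into the word
  but no word over \<open>A - X\<close> with one letter more does; the latter caps the length of the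
  projection.\<close>

lemma piecewise_testable_projection:
  assumes "finite A" "s \<in> lists (A - X)"
  shows "piecewise_testable A {w \<in> lists A. filter (\<lambda>a. a \<notin> X) w = s}"
proof -
  let ?p = "filter (\<lambda>a. a \<notin> X)"
  define T where "T = {t \<in> lists (A - X). length t = Suc (length s)}"
  have sub: "subseq t w \<longleftrightarrow> subseq t (?p w)" if "t \<in> lists (A - X)" for t w
  proof
    assume "subseq t w"
    then have "subseq (?p t) (?p w)" by (rule subseq_filter)
    moreover have "?p t = t" using that by (auto intro: filter_True)
    ultimately show "subseq t (?p w)" by simp
  next
    show "subseq t (?p w) \<Longrightarrow> subseq t w"
      by (rule subseq_order.order_trans[OF _ subseq_filter_left])
  qed
  have "{w \<in> lists A. ?p w = s} = {w \<in> lists A. \<exists>m\<in>{s}. subseq m w} - {w \<in> lists A. \<exists>m\<in>T. subseq m w}"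
  proof (intro Set.set_eqI iffI)
    fix w assume w: "w \<in> {w \<in> lists A. ?p w = s}"
    have "\<not> subseq t w" if "t \<in> T" for t
      using that w sub[of t w] list_emb_length[of _ t s] unfolding T_def by fastforce
    then show "w \<in> {w \<in> lists A. \<exists>m\<in>{s}. subseq m w} - {w \<in> lists A. \<exists>m\<in>T. subseq m w}"
      using w sub[OF assms(2), of w] by auto
  next
    fix w assume w: "w \<in> {w \<in> lists A. \<exists>m\<in>{s}. subseq m w} - {w \<in> lists A. \<exists>m\<in>T. subseq m w}"
    then have s: "subseq s (?p w)" using sub[OF assms(2), of w] by auto
    have pw: "?p w \<in> lists (A - X)" using w by auto
    have "\<not> length s < length (?p w)"
    proof
      assume "length s < length (?p w)"
      then obtain u where u: "subseq u (?p w)" "length u = Suc (length s)"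
        using subseq_length_ex[of "Suc (length s)" "?p w"] by auto
      have "set u \<subseteq> set (?p w)" using u(1) by (metis notin_set_nthsI subseq_conv_nths subsetI)
      then have "u \<in> lists (A - X)" using pw by (auto simp: subset_iff)
      then have "u \<in> T" "subseq u w" using u sub[of u w] by (simp_all add: T_def)
      then show False using w by auto
    qed
    then have "?p w = s" using s by (metis le_neq_implies_less list_emb_length subseq_same_length)
    then show "w \<in> {w \<in> lists A. ?p w = s}" using w by auto
  qed
  moreover have "finite T"
    using assms(1) finite_lists_length_eq[of "A - X" "Suc (length s)"]
    by (simp add: T_def lists_eq_set)
  moreover have "T \<subseteq> lists A" "{s} \<subseteq> lists A" using assms(2) by (auto simp: T_def)
  ultimately show ?thesis
    using piecewise_testable_Diff[OF piecewise_testable_up_closure[of "{s}" A]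
        piecewise_testable_up_closure[of T A]] by simp
qed

text \<open>As the projections agree, all letters of \<open>w\<close> missing from \<open>m\<close>
  lie in \<open>X\<close>, and deleting them one at a time stays inside \<open>L\<close>.\<close>

lemma deletion_closed_subseq:
  assumes del: "\<And>u x v. u @ x # v \<in> L \<Longrightarrow> x \<in> X \<Longrightarrow> u @ v \<in> L"
    and "subseq m w" "filter (\<lambda>a. a \<notin> X) m = filter (\<lambda>a. a \<notin> X) w" "w \<in> L"
  shows "m \<in> L"
proof -
  \<comment> \<open>The prefix \<open>p\<close> holds the letters already matched, so that the
    induction can delete in the middle of a word.\<close>
  have "p @ m \<in> L" if "p @ w \<in> L" for p
    using assms(2,3) that
  proof (induction arbitrary: p rule: list_emb.induct)
    case (list_emb_Nil ys)
    then show ?case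
    proof (induction ys)
      case (Cons y ys)
      then show ?case using del[of p y ys] by (auto split: if_splits)
    qed simp
  next
    case (list_emb_Cons xs ys y)
    have "y \<in> X"
    proof (rule ccontr)
      assume "y \<notin> X"
      then have "length (filter (\<lambda>a. a \<notin> X) ys) < length (filter (\<lambda>a. a \<notin> X) xs)"
        using list_emb_Cons.prems by simp
      then show False
        using subseq_filter[OF list_emb_Cons.hyps, of "\<lambda>a. a \<notin> X"] by (simp add: list_emb_length leD)
    qed
    then show ?case using list_emb_Cons.IH[of p] list_emb_Cons.prems del[of p y ys] by simp
  next
    case (list_emb_Cons2 x y xs ys)
    then show ?case using list_emb_Cons2.IH[of "p @ [x]"] by (auto split: if_splits)
  qed
  from this[of "[]"] show ?thesis using assms(4) by simp
qed

text \<open>Among the words with a fixed projection \<open>s\<close>, the complement of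
  \<open>L\<close> is closed under extension by letters of \<open>X\<close>, hence determined by the
  finite basis \<open>M\<close> of its minimal words. The bound \<open>k\<close> leaves finitely
  many projections \<open>s\<close>.\<close>

lemma piecewise_testable_deletion_closed:
  assumes "finite A" "L \<subseteq> lists A"
    and del: "\<And>u x v. u @ x # v \<in> L \<Longrightarrow> x \<in> X \<Longrightarrow> u @ v \<in> L"
    and bound: "\<And>w. w \<in> L \<Longrightarrow> length (filter (\<lambda>a. a \<notin> X) w) \<le> k"
  shows "piecewise_testable A L"
proof -
  let ?p = "filter (\<lambda>a. a \<notin> X)"
  let ?S = "\<lambda>s. {w \<in> lists A. ?p w = s}"
  have "piecewise_testable A (L \<inter> ?S s)" if s: "s \<in> lists (A - X)" for s
  proof -
    have "?S s - L \<subseteq> lists A" by blast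
    from finite_subseq_basis[OF assms(1) this] obtain M where
      M: "finite M" "M \<subseteq> ?S s - L" "\<And>b. b \<in> ?S s - L \<Longrightarrow> \<exists>m\<in>M. subseq m b"
      by blast
    have "m \<notin> L" "?p m = s" if "m \<in> M" for m using that M(2) by auto
    then have "\<not> subseq m w" if "w \<in> L \<inter> ?S s" "m \<in> M" for m w
      using deletion_closed_subseq[of L X m w, OF del] that by auto
    then have "L \<inter> ?S s = ?S s - {w \<in> lists A. \<exists>m\<in>M. subseq m w}"
      using M(3) by blast
    moreover have "M \<subseteq> lists A" using M(2) by blast
    ultimately show ?thesis
      using piecewise_testable_Diff[OF piecewise_testable_projection[OF assms(1) s]
          piecewise_testable_up_closure[OF M(1)]] by simp
  qed
  then have "piecewise_testable A (\<Union>s\<in>{s \<in> lists (A - X). length s \<le> k}. L \<inter> ?S s)"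
    using assms(1) by (intro piecewise_testable_UN finite_lists_bounded_length) auto
  moreover have "(\<Union>s\<in>{s \<in> lists (A - X). length s \<le> k}. L \<inter> ?S s) = L"
    using assms(2) bound by (auto simp: lists_eq_set subset_iff)
  ultimately show ?thesis by simp
qed


section \<open>Generators adapted to an abelian normal subgroup\<close>

text \<open>
  The letters of \<open>X\<close> come from an abelian normal subgroup of finite index, those of \<open>Y\<close> from
  representatives of its cosets; only the properties below matter. By \<open>X_conj\<close>, letters of \<open>X\<close> can
  be moved past any word, so the two product rules limit the letters outside \<open>X\<close> to two in a
  geodesic, and to a single final one in a shortlex normal form.
\<close>

locale split_generators = group G for G (structure) +
  fixes X Y Z :: "'a set"
  assumes finite_X: "finite X" and finite_Y: "finite Y"
    and X_carrier: "X \<subseteq> carrier G" and Y_carrier: "Y \<subseteq> carrier G"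
    and X_comm: "\<And>x x'. x \<in> X \<Longrightarrow> x' \<in> X \<Longrightarrow> x \<otimes> x' = x' \<otimes> x"
    and X_conj: "\<And>x g. x \<in> X \<Longrightarrow> g \<in> carrier G \<Longrightarrow> g \<otimes> x \<otimes> inv g \<in> X"
    and X_inv: "\<And>x. x \<in> X \<Longrightarrow> inv x \<in> X" and Y_inv: "\<And>y. y \<in> Y \<Longrightarrow> inv y \<in> Y"
    and Y_Y: "\<And>y1 y2. y1 \<in> Y \<Longrightarrow> y2 \<in> Y \<Longrightarrow> \<exists>x\<in>X. \<exists>y\<in>Y. y1 \<otimes> y2 = x \<otimes> y"
    and Y_Y_Y: "\<And>y1 y2 y3. y1 \<in> Y \<Longrightarrow> y2 \<in> Y \<Longrightarrow> y3 \<in> Y \<Longrightarrow>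
      \<exists>x\<in>X. \<exists>y\<in>Y. y1 \<otimes> y2 \<otimes> y3 = x \<otimes> y"
    and Z_def: "Z = X \<union> Y"
    and generate_Z: "generate G Z = carrier G"
begin

abbreviation val :: "'a list \<Rightarrow> 'a" where "val \<equiv> word_value G"

abbreviation outer :: "'a list \<Rightarrow> 'a list" where "outer \<equiv> filter (\<lambda>z. z \<notin> X)"

lemma finite_Z: "finite Z" and Z_carrier: "Z \<subseteq> carrier G"
  and Z_inv: "z \<in> Z \<Longrightarrow> inv z \<in> Z"
  using finite_X finite_Y X_carrier Y_carrier X_inv Y_inv by (auto simp: Z_def)

lemma X_closed [simp]: "x \<in> X \<Longrightarrow> x \<in> carrier G"
  and Y_closed [simp]: "y \<in> Y \<Longrightarrow> y \<in> carrier G"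
  and Z_closed [simp]: "z \<in> Z \<Longrightarrow> z \<in> carrier G"
  and X_Z [simp]: "x \<in> X \<Longrightarrow> x \<in> Z"
  and Y_Z [simp]: "y \<in> Y \<Longrightarrow> y \<in> Z"
  using X_carrier Y_carrier Z_carrier by (auto simp: Z_def)

lemma lists_X_Z [simp]: "u \<in> lists X \<Longrightarrow> u \<in> lists Z"
  by (auto simp: lists_eq_set subset_iff)

lemma cancel_left [simp]:
  assumes "g \<in> carrier G" "a \<in> carrier G"
  shows "inv g \<otimes> (g \<otimes> a) = a" "g \<otimes> (inv g \<otimes> a) = a"
  using assms by (simp_all add: m_assoc[symmetric])

lemma val_Nil [simp]: "val [] = \<one>" and val_Cons [simp]: "val (a # w) = a \<otimes> val w"
  by (simp_all add: word_value_def)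

lemma val_closed [simp]: "w \<in> lists Z \<Longrightarrow> val w \<in> carrier G"
  by (induction w) auto

lemma val_append: "u \<in> lists Z \<Longrightarrow> v \<in> lists Z \<Longrightarrow> val (u @ v) = val u \<otimes> val v"
  by (induction u) (auto simp: m_assoc)

text \<open>Conjugation by \<open>g\<close> acts letter by letter and maps \<open>X\<close> into
  itself, so the length is preserved.\<close>

lemma move_past:
  assumes "g \<in> carrier G" "u \<in> lists X"
  shows "\<exists>u'\<in>lists X. length u' = length u \<and> g \<otimes> val u = val u' \<otimes> g"
  using assms(2)
proof (induction u)
  case (Cons x u)
  then obtain u' where u': "x \<in> X" "u \<in> lists X" "u' \<in> lists X" "length u' = length u"
    "g \<otimes> val u = val u' \<otimes> g" by auto
  let ?x = "g \<otimes> x \<otimes> inv g"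
  have "g \<otimes> (x \<otimes> val u) = ?x \<otimes> (g \<otimes> val u)"
    using u'(1,2) assms(1) by (simp add: m_assoc)
  also have "\<dots> = ?x \<otimes> val u' \<otimes> g"
    using u' assms(1) by (simp add: m_assoc)
  finally show ?case
    using u' X_conj[OF u'(1) assms(1)] by (intro bexI[of _ "?x # u'"]) auto
qed (use assms in auto)

lemma val_insert:
  assumes "u \<in> lists Z" "v \<in> lists Z" "x \<in> X"
  shows "\<exists>x'\<in>X. val (u @ x # v) = x' \<otimes> val (u @ v)"
proof
  let ?x = "val u \<otimes> x \<otimes> inv (val u)"
  show "?x \<in> X" using X_conj assms by simp
  show "val (u @ x # v) = ?x \<otimes> val (u @ v)"
    using assms by (simp add: val_append m_assoc)
qed

text \<open>All letters of \<open>X\<close> can be gathered at the front without lengthening the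
  word: by \<open>move_past\<close> they change to other letters of \<open>X\<close>, while the
  outer letters keep their order.\<close>

lemma collect:
  assumes "w \<in> lists Z"
  shows "\<exists>u\<in>lists X. length u + length (outer w) = length w \<and> val w = val u \<otimes> val (outer w)"
  using assms
proof (induction w)
  case Nil
  show ?case by (intro bexI[of _ "[]"]) auto
next
  case (Cons z w)
  then obtain u where u: "z \<in> Z" "w \<in> lists Z" "u \<in> lists X"
    "length u + length (outer w) = length w" "val w = val u \<otimes> val (outer w)" by auto
  have outer: "outer w \<in> lists Z" using u(2) by auto
  show ?case
  proof (cases "z \<in> X")
    case True
    then show ?thesis using u outer by (intro bexI[of _ "z # u"]) (auto simp: m_assoc)
  next
    case False
    obtain u' where u': "u' \<in> lists X" "length u' = length u" "z \<otimes> val u = val u' \<otimes> z"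
      using move_past[of z u] u by auto
    have "z \<otimes> val w = z \<otimes> val u \<otimes> val (outer w)"
      using u outer by (simp add: m_assoc)
    also have "\<dots> = val u' \<otimes> (z \<otimes> val (outer w))"
      using u u' outer by (simp add: m_assoc)
    finally show ?thesis using False u u' by (intro bexI[of _ "u'"]) auto
  qed
qed

lemma outer_Y: "w \<in> lists Z \<Longrightarrow> outer w \<in> lists Y"
  by (auto simp: Z_def)

lemma ex_word:
  assumes "g \<in> carrier G"
  shows "\<exists>w\<in>lists Z. val w = g"
proof -
  have "g \<in> generate G Z" using assms generate_Z by simp
  then show ?thesis
  proof (induction rule: generate.induct)
    case one
    show ?case by (intro bexI[of _ "[]"]) auto
  next
    case (incl h)
    then show ?case by (intro bexI[of _ "[h]"]) auto
  next
    case (inv h)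
    then show ?case using Z_inv by (intro bexI[of _ "[inv h]"]) auto
  next
    case (eng h1 h2)
    then obtain u v where "u \<in> lists Z" "val u = h1" "v \<in> lists Z" "val v = h2" by auto
    then show ?case by (intro bexI[of _ "u @ v"]) (auto simp: val_append)
  qed
qed

section \<open>Lengths, geodesics and the language \<open>ConjGeo\<close>\<close>

lemma group_length_le: "w \<in> lists Z \<Longrightarrow> group_length G Z (val w) \<le> length w"
  unfolding group_length_def representatives_def by (rule Least_le) auto

lemma group_length_ex:
  assumes "g \<in> carrier G"
  shows "\<exists>w\<in>lists Z. val w = g \<and> length w = group_length G Z g"
proof -
  have "\<exists>n. \<exists>w\<in>representatives G Z g. length w = n"
    using ex_word[OF assms] by (auto simp: representatives_def)
  from LeastI_ex[OF this] show ?thesis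
    unfolding group_length_def by (auto simp: representatives_def)
qed

lemma conj_length_le: "conjugate_in G h g \<Longrightarrow> conj_length G Z g \<le> group_length G Z h"
  unfolding conj_length_def by (rule Least_le) auto

lemma conjugate_refl: "g \<in> carrier G \<Longrightarrow> conjugate_in G g g"
  unfolding conjugate_in_def by (intro bexI[of _ \<one>]) auto

lemma conj_length_ex:
  assumes "g \<in> carrier G"
  shows "\<exists>h. conjugate_in G h g \<and> group_length G Z h = conj_length G Z g"
proof -
  have "\<exists>n. \<exists>h. conjugate_in G h g \<and> group_length G Z h = n"
    using conjugate_refl[OF assms] by auto
  from LeastI_ex[OF this] show ?thesis
    unfolding conj_length_def by auto
qed

definition geodesic :: "'a list \<Rightarrow> bool" where
  "geodesic w \<longleftrightarrow> w \<in> lists Z \<and> (\<forall>v\<in>lists Z. val v = val w \<longrightarrow> length w \<le> length v)"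

lemma geodesic_iff: "geodesic w \<longleftrightarrow> w \<in> lists Z \<and> length w = group_length G Z (val w)"
  unfolding geodesic_def using group_length_le group_length_ex val_closed
  by (metis dual_order.antisym)

text \<open>After \<open>collect\<close>, three outer letters would stand next to each other, and
  \<open>Y_Y_Y\<close> would replace them by two letters, giving a shorter word.\<close>

lemma geodesic_outer:
  assumes "geodesic w"
  shows "length (outer w) \<le> 2"
proof (rule ccontr)
  assume "\<not> length (outer w) \<le> 2"
  then obtain y1 y2 y3 t where t: "outer w = y1 # y2 # y3 # t"
    by (cases "outer w" rule: list.exhaust; cases "tl (outer w)"; cases "tl (tl (outer w))") auto
  have w: "w \<in> lists Z" using assms by (simp add: geodesic_def)
  then have Y: "y1 \<in> Y" "y2 \<in> Y" "y3 \<in> Y" "t \<in> lists Z"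
    using outer_Y[OF w] t by (auto simp: lists_eq_set subset_iff)
  obtain u where u: "u \<in> lists X" "length u + length (outer w) = length w"
    "val w = val u \<otimes> val (outer w)" using collect[OF w] by auto
  obtain x y where xy: "x \<in> X" "y \<in> Y" "y1 \<otimes> y2 \<otimes> y3 = x \<otimes> y"
    using Y_Y_Y[OF Y(1-3)] by auto
  have "y1 \<otimes> (y2 \<otimes> (y3 \<otimes> val t)) = y1 \<otimes> y2 \<otimes> y3 \<otimes> val t"
    using Y by (simp add: m_assoc)
  also have "\<dots> = x \<otimes> (y \<otimes> val t)" unfolding xy(3) using xy Y by (simp add: m_assoc)
  finally have "val (u @ x # y # t) = val w"
    using u t xy Y by (simp add: val_append)
  moreover have "length (u @ x # y # t) < length w" using u(2) t by simp
  moreover have "u @ x # y # t \<in> lists Z" using u xy Y by simp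
  ultimately show False using assms unfolding geodesic_def by (meson leD)
qed

text \<open>Every element is conjugate to itself, so the conjugacy length is at most the length of
  the element.\<close>

lemma ConjGeo_geodesic:
  assumes "w \<in> ConjGeo G Z"
  shows "geodesic w"
proof -
  have w: "w \<in> lists Z" "length w = conj_length G Z (val w)"
    using assms by (simp_all add: ConjGeo_def)
  then have "length w \<le> group_length G Z (val w)"
    using conj_length_le conjugate_refl by simp
  then have "length w = group_length G Z (val w)"
    using group_length_le[OF w(1)] by (rule antisym)
  then show ?thesis using w(1) geodesic_iff by blast
qed

text \<open>Deleting \<open>x\<close> shortens the word by one, so it suffices that the conjugacy
  length drops by at most one. The conjugation taking \<open>val (u @ v)\<close> to a shortest
  conjugate \<open>h\<close> takes \<open>val (u @ x # v)\<close> to a letter of \<open>X\<close>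
  times \<open>h\<close>.\<close>

lemma ConjGeo_delete:
  assumes w: "u @ x # v \<in> ConjGeo G Z" and x: "x \<in> X"
  shows "u @ v \<in> ConjGeo G Z"
proof -
  have uv: "u \<in> lists Z" "v \<in> lists Z" using w by (auto simp: ConjGeo_def)
  obtain x' where x': "x' \<in> X" "val (u @ x # v) = x' \<otimes> val (u @ v)"
    using val_insert uv x by blast
  have cl: "val (u @ v) \<in> carrier G" using uv by simp
  then obtain h where h: "conjugate_in G h (val (u @ v))"
    "group_length G Z h = conj_length G Z (val (u @ v))"
    using conj_length_ex by blast
  then obtain k where k: "k \<in> carrier G" "h = inv k \<otimes> val (u @ v) \<otimes> k"
    unfolding conjugate_in_def by auto
  obtain t where t: "t \<in> lists Z" "val t = h" "length t = group_length G Z h"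
    using group_length_ex[of h] k cl by auto
  let ?x = "inv k \<otimes> x' \<otimes> k"
  have x'': "?x \<in> X" using X_conj[OF x'(1), of "inv k"] k by simp
  have "?x \<otimes> h = inv k \<otimes> val (u @ x # v) \<otimes> k"
    unfolding k(2) x'(2) using x' k cl by (simp add: m_assoc)
  then have "conjugate_in G (val (?x # t)) (val (u @ x # v))"
    unfolding conjugate_in_def using t k by auto
  then have "conj_length G Z (val (u @ x # v)) \<le> group_length G Z (val (?x # t))"
    by (rule conj_length_le)
  also have "\<dots> \<le> Suc (length t)"
    using group_length_le[of "?x # t"] t x'' by simp
  finally have "length (u @ v) \<le> conj_length G Z (val (u @ v))"
    using w t(3) h(2) by (simp add: ConjGeo_def)
  moreover have "conj_length G Z (val (u @ v)) \<le> length (u @ v)"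
    using conj_length_le[OF conjugate_refl[OF cl]] group_length_le[of "u @ v"] uv by auto
  ultimately show ?thesis using uv by (simp add: ConjGeo_def)
qed

lemma piecewise_testable_ConjGeo: "piecewise_testable Z (ConjGeo G Z)"
proof (rule piecewise_testable_deletion_closed[of Z _ X 2])
  show "ConjGeo G Z \<subseteq> lists Z" by (auto simp: ConjGeo_def)
qed (use finite_Z ConjGeo_delete ConjGeo_geodesic geodesic_outer in auto)

end


section \<open>Shortlex normal forms\<close>

lemma lex_total:
  assumes "\<And>a b. a \<in> A \<Longrightarrow> b \<in> A \<Longrightarrow> a \<noteq> b \<Longrightarrow> (a, b) \<in> r \<or> (b, a) \<in> r"
    and "length u = length v" "u \<in> lists A" "v \<in> lists A" "u \<noteq> v"
  shows "(u, v) \<in> lex r \<or> (v, u) \<in> lex r"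
  using assms(2-)
proof (induction u v rule: list_induct2)
  case (Cons a u b v)
  then show ?case using assms(1)[of a b] by auto
qed simp

text \<open>Before the first difference \<open>x\<close> is placed alike in both words. At that
  position it goes in front of both letters, or behind both, or only in front of the larger one, and
  then it still exceeds the smaller one.\<close>

lemma insort_key_lex:
  assumes "length u = length v" and "(u, v) \<in> lex {(a, b). a \<in> Z \<and> b \<in> Z \<and> f a < (f b :: 'b :: linorder)}"
    and "x \<in> Z"
  shows "(insort_key f x u, insort_key f x v) \<in> lex {(a, b). a \<in> Z \<and> b \<in> Z \<and> f a < f b}"
  using assms(1,2)
proof (induction u v rule: list_induct2)
  case (Cons a u b v)
  then show ?case using assms(3) by (auto simp: not_le)
qed simp

lemma sorted_key_unique:
  assumes "sorted (map f u)" "sorted (map f v)" "mset u = mset v" "inj_on f (set u)"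
  shows "u = v"
proof -
  have "mset (map f u) = mset (map f v)" using assms(3) by simp
  then have "map f u = map f v" using assms(1,2) by (metis sorted_sort_id properties_for_sort)
  moreover have "set u = set v" using assms(3) by (metis set_mset_mset)
  ultimately show ?thesis using assms(4) by (simp add: map_inj_on)
qed

text \<open>The order of the letters is encoded by an injective numbering, so that
  \<open>sorted\<close> and \<open>insort_key\<close> can be used with the key
  \<open>rank\<close>.\<close>

locale ordered_split_generators = split_generators +
  fixes rank :: "'a \<Rightarrow> nat"
  assumes rank_inj: "inj_on rank Z"
    and rank_X: "\<And>x z. x \<in> X \<Longrightarrow> z \<in> Z \<Longrightarrow> z \<notin> X \<Longrightarrow> rank x < rank z"
begin

definition rank_order :: "'a rel" where "rank_order = {(a, b). a \<in> Z \<and> b \<in> Z \<and> rank a \<le> rank b}"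

abbreviation lt :: "'a rel" where "lt \<equiv> {(a, b). a \<in> Z \<and> b \<in> Z \<and> rank a < rank b}"

lemma rank_order_minus_Id: "rank_order - Id = lt"
  using rank_inj by (auto simp: rank_order_def inj_on_def order_less_le)

lemma linear_order_rank_order: "linear_order_on Z rank_order"
  using rank_inj unfolding linear_order_on_def partial_order_on_def preorder_on_def refl_on_def trans_on_def
    antisym_on_def total_on_def rank_order_def inj_on_def by force

lemma shortlex_iff:
  "(u, v) \<in> shortlex rank_order \<longleftrightarrow> length u < length v \<or> length u = length v \<and> (u, v) \<in> lex lt"
  unfolding shortlex_def rank_order_minus_Id lenlex_conv by auto

lemma wf_shortlex: "wf (shortlex rank_order)"
proof -
  have "lt \<subseteq> measure rank" by auto
  then have "wf lt" by (rule wf_subset[OF wf_measure])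
  then show ?thesis unfolding shortlex_def rank_order_minus_Id by (rule wf_lenlex)
qed

lemma shortlex_total:
  assumes "u \<in> lists Z" "v \<in> lists Z" "u \<noteq> v"
  shows "(u, v) \<in> shortlex rank_order \<or> (v, u) \<in> shortlex rank_order"
proof (cases "length u = length v")
  case True
  have total: "(a, b) \<in> lt \<or> (b, a) \<in> lt" if "a \<in> Z" "b \<in> Z" "a \<noteq> b" for a b
    using that inj_onD[OF rank_inj, of a b] by (cases "rank a" "rank b" rule: linorder_cases) auto
  have "(u, v) \<in> lex lt \<or> (v, u) \<in> lex lt"
    by (rule lex_total[of Z]) (use total True assms in blast)+
  then show ?thesis using True by (simp add: shortlex_iff)
qed (auto simp: shortlex_iff)

lemma shortlex_asym: "(u, v) \<in> shortlex rank_order \<Longrightarrow> (v, u) \<notin> shortlex rank_order"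
  using wf_shortlex by (simp add: wf_not_sym)

text \<open>Membership in the set of normal forms, phrased without the definite description in
  \<open>shortlex_rep\<close>; totality of \<open>shortlex\<close> on words over \<open>Z\<close>
  makes both agree.\<close>

definition shortlex_least :: "'a list \<Rightarrow> bool" where
  "shortlex_least w \<longleftrightarrow> w \<in> lists Z \<and> (\<forall>v\<in>lists Z. val v = val w \<longrightarrow> (v, w) \<notin> shortlex rank_order)"

lemma least_ex:
  assumes "g \<in> carrier G"
  shows "\<exists>w. shortlex_least w \<and> val w = g"
proof -
  have "representatives G Z g \<noteq> {}" using ex_word[OF assms] by (auto simp: representatives_def)
  then obtain w where "w \<in> representatives G Z g"
      "\<And>v. (v, w) \<in> shortlex rank_order \<Longrightarrow> v \<notin> representatives G Z g"
    using wfE_min'[OF wf_shortlex] by metis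
  then show ?thesis unfolding shortlex_least_def representatives_def by auto
qed

lemma least_unique: "shortlex_least u \<Longrightarrow> shortlex_least v \<Longrightarrow> val u = val v \<Longrightarrow> u = v"
  using shortlex_total unfolding shortlex_least_def by metis

lemma least_less: "shortlex_least u \<Longrightarrow> v \<in> lists Z \<Longrightarrow> val v = val u \<Longrightarrow> v \<noteq> u \<Longrightarrow> (u, v) \<in> shortlex rank_order"
  using shortlex_total unfolding shortlex_least_def by metis

lemma shortlex_rep_eqI:
  assumes "shortlex_least w" "val w = g"
  shows "shortlex_rep G Z rank_order g = w"
  unfolding shortlex_rep_def
proof (rule the_equality)
  show "w \<in> representatives G Z g \<and> (\<forall>v\<in>representatives G Z g. v \<noteq> w \<longrightarrow> (w, v) \<in> shortlex rank_order)"
    using assms least_less by (auto simp: representatives_def shortlex_least_def)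
next
  fix u assume u: "u \<in> representatives G Z g \<and> (\<forall>v\<in>representatives G Z g. v \<noteq> u \<longrightarrow> (u, v) \<in> shortlex rank_order)"
  then have "shortlex_least u" unfolding shortlex_least_def representatives_def
    using shortlex_asym by fastforce
  then show "u = w" using u assms least_unique by (auto simp: representatives_def)
qed

lemma SL_eq: "SL G Z rank_order = {w. shortlex_least w}"
proof (intro Set.set_eqI iffI)
  fix w assume "w \<in> SL G Z rank_order"
  then obtain g where "g \<in> carrier G" "w = shortlex_rep G Z rank_order g" by (auto simp: SL_def)
  then show "w \<in> {w. shortlex_least w}" using least_ex shortlex_rep_eqI by (metis mem_Collect_eq)
next
  fix w assume "w \<in> {w. shortlex_least w}"
  then have "w = shortlex_rep G Z rank_order (val w)" "val w \<in> carrier G"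
    using shortlex_rep_eqI by (auto simp: shortlex_least_def)
  then show "w \<in> SL G Z rank_order" by (auto simp: SL_def)
qed

lemma least_geodesic: "shortlex_least w \<Longrightarrow> geodesic w"
  unfolding shortlex_least_def geodesic_def shortlex_iff by (meson not_le)

text \<open>A normal form is geodesic, so its length is that of its element, and the length
  condition on the element becomes membership in \<open>ConjGeo\<close>.\<close>

lemma ConjMinLenSL_eq: "ConjMinLenSL G Z rank_order = SL G Z rank_order \<inter> ConjGeo G Z"
proof (intro Set.set_eqI iffI)
  fix w assume "w \<in> ConjMinLenSL G Z rank_order"
  then obtain g where g: "g \<in> carrier G" "w = shortlex_rep G Z rank_order g"
    "group_length G Z g = conj_length G Z g" by (auto simp: ConjMinLenSL_def)
  then have "shortlex_least w" "val w = g" using least_ex[OF g(1)] shortlex_rep_eqI by metis+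
  then show "w \<in> SL G Z rank_order \<inter> ConjGeo G Z"
    using g least_geodesic geodesic_iff by (simp add: SL_eq ConjGeo_def)
next
  fix w assume "w \<in> SL G Z rank_order \<inter> ConjGeo G Z"
  then have w: "shortlex_least w" "w \<in> ConjGeo G Z" by (auto simp: SL_eq)
  then have "w = shortlex_rep G Z rank_order (val w)" "val w \<in> carrier G"
    using shortlex_rep_eqI by (auto simp: shortlex_least_def)
  moreover have "group_length G Z (val w) = conj_length G Z (val w)"
    using w ConjGeo_geodesic geodesic_iff by (simp add: ConjGeo_def)
  ultimately show "w \<in> ConjMinLenSL G Z rank_order" by (auto simp: ConjMinLenSL_def)
qed

text \<open>If \<open>v\<close> were nonempty, \<open>z # v\<close> could be rewritten with the same
  length so as to begin with a letter of \<open>X\<close>, which ranks below \<open>z\<close>. If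
  \<open>v\<close> contains a letter of \<open>X\<close>, \<open>collect\<close> brings one to the
  front; otherwise \<open>Y_Y\<close> applies to the first two letters.\<close>

lemma least_first_outer:
  assumes w: "shortlex_least (u @ z # v)" and u: "u \<in> lists X" and z: "z \<notin> X"
  shows "v = []"
proof (rule ccontr)
  assume "v \<noteq> []"
  have zv: "z \<in> Z" "v \<in> lists Z" using w by (auto simp: shortlex_least_def)
  have "\<exists>x\<in>X. \<exists>t\<in>lists Z. length t = length v \<and> val (x # t) = val (z # v)"
  proof -
    have "z # v \<in> lists Z" using zv by simp
    from collect[OF this] obtain a where a: "a \<in> lists X"
      "length a + length (outer (z # v)) = length (z # v)" "val (z # v) = val a \<otimes> val (outer (z # v))"
      by blast
    have outer: "outer (z # v) \<in> lists Y" using zv outer_Y[of "z # v"] by simp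
    then have outer_Z: "outer (z # v) \<in> lists Z" by (auto simp: lists_eq_set subset_iff)
    show ?thesis
    \<comment> \<open>\<open>a\<close> consists of the collected letters; if it is empty, then
      \<open>z # v\<close> has only outer letters.\<close>
    proof (cases a)
      case (Cons x b)
      then show ?thesis using a outer_Z
        by (intro bexI[of _ x] bexI[of _ "b @ outer (z # v)"]) (auto simp: val_append m_assoc)
    next
      case Nil
      then have "length (outer v) = length v" using a(2) z by simp
      then have "outer v = v" by (metis length_filter_less filter_True less_irrefl)
      then obtain y t where t: "outer v = y # t" "v = y # t" using \<open>v \<noteq> []\<close> by (cases v) auto
      then have Y: "z \<in> Y" "y \<in> Y" "t \<in> lists Z" using outer outer_Z z by auto
      obtain x y' where xy: "x \<in> X" "y' \<in> Y" "z \<otimes> y = x \<otimes> y'" using Y_Y[OF Y(1,2)] by auto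
      have "val (z # v) = z \<otimes> y \<otimes> val t" using t Y by (simp add: m_assoc)
      also have "\<dots> = val (x # y' # t)" unfolding xy(3) using xy Y by (simp add: m_assoc)
      finally show ?thesis using t xy Y by (intro bexI[of _ x] bexI[of _ "y' # t"]) auto
    qed
  qed
  then obtain x t where t: "x \<in> X" "t \<in> lists Z" "length t = length v" "val (x # t) = val (z # v)"
    by blast
  have "val (u @ x # t) = val (u @ z # v)"
    using t zv u val_append[of u "x # t"] val_append[of u "z # v"] by simp
  moreover have "(u @ x # t, u @ z # v) \<in> shortlex rank_order"
  proof -
    have "(x # t, z # v) \<in> lex lt" using rank_X t zv z by auto
    then have "(u @ x # t, u @ z # v) \<in> lex lt" by (rule lex_append_leftI)
    then show ?thesis using t(3) by (simp add: shortlex_iff)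
  qed
  moreover have "u @ x # t \<in> lists Z" using u t by simp
  ultimately show False using w unfolding shortlex_least_def by blast
qed

lemma least_cases:
  assumes "shortlex_least w"
  obtains "w \<in> lists X" | u y where "w = u @ [y]" "u \<in> lists X" "y \<in> Z" "y \<notin> X"
proof (cases "w \<in> lists X")
  case False
  then have "\<exists>z\<in>set w. z \<notin> X" by auto
  then obtain u y v where w: "w = u @ y # v" "y \<notin> X" "\<forall>z\<in>set u. \<not> z \<notin> X"
    by (rule split_list_first_propE)
  then have u: "u \<in> lists X" by auto
  have "v = []" using least_first_outer assms w u by blast
  moreover have "y \<in> Z" using assms w by (auto simp: shortlex_least_def)
  ultimately show thesis using that(2) w u by blast
qed

lemma least_outer: "shortlex_least w \<Longrightarrow> length (outer w) \<le> 1"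
  by (erule least_cases) (auto simp: filter_empty_conv lists_eq_set subset_iff)

text \<open>In a descent both letters lie in \<open>X\<close>: \<open>a\<close> because it is not
  the last letter, \<open>b\<close> because it ranks below \<open>a\<close>. They commute, and the
  swapped word would be smaller.\<close>

lemma least_swap:
  assumes w: "shortlex_least (u @ a # b # v)"
  shows "rank a \<le> rank b"
proof (rule ccontr)
  assume ba: "\<not> rank a \<le> rank b"
  have uv: "u \<in> lists Z" "v \<in> lists Z" "a \<in> Z" "b \<in> Z" using w by (auto simp: shortlex_least_def)
  have a: "a \<in> X"
    using w
  proof (cases rule: least_cases)
    case (2 u' y)
    then have "a \<in> set u'" by (cases v rule: rev_cases) (auto simp: append_eq_append_conv2 append_eq_Cons_conv)
    then show ?thesis using 2 by auto
  qed auto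
  have b: "b \<in> X" using a ba rank_X uv by force
  have "val (u @ b # a # v) = val (u @ a # b # v)"
    using a b uv X_comm[OF a b] by (simp add: val_append m_assoc[symmetric])
  moreover have "(b # a # v, a # b # v) \<in> lex lt" using ba uv by simp
  then have "(u @ b # a # v, u @ a # b # v) \<in> shortlex rank_order"
    unfolding shortlex_iff by (simp add: lex_append_leftI)
  moreover have "u @ b # a # v \<in> lists Z" using uv by simp
  ultimately show False using w unfolding shortlex_least_def by blast
qed

lemma least_sorted:
  assumes "shortlex_least w"
  shows "sorted (map rank w)"
proof -
  have "rank (w ! i) \<le> rank (w ! Suc i)" if "Suc i < length w" for i
  proof -
    have "w = take i w @ w ! i # w ! Suc i # drop (Suc (Suc i)) w"
      using that by (simp add: Cons_nth_drop_Suc)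
    then show ?thesis using least_swap assms by metis
  qed
  then show ?thesis by (simp add: sorted_iff_nth_Suc)
qed

text \<open>On its way \<open>x\<close> passes only letters of smaller rank; these belong to
  \<open>X\<close> and commute with \<open>x\<close>.\<close>

lemma val_insort:
  assumes "x \<in> X" "w \<in> lists Z"
  shows "val (insort_key rank x w) = x \<otimes> val w"
  using assms(2)
proof (induction w)
  case (Cons a w)
  then have aw: "a \<in> Z" "w \<in> lists Z" by auto
  show ?case
  proof (cases "rank x \<le> rank a")
    case False
    then have a: "a \<in> X" using rank_X[OF assms(1)] aw by force
    have "a \<otimes> (x \<otimes> val w) = x \<otimes> (a \<otimes> val w)"
      using a assms(1) X_comm[OF a assms(1)] aw by (simp add: m_assoc[symmetric])
    then show ?thesis using False Cons aw by simp
  qed simp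
qed simp

lemma insort_lists: "x \<in> Z \<Longrightarrow> w \<in> lists Z \<Longrightarrow> insort_key rank x w \<in> lists Z"
  by (auto simp: lists_eq_set set_insort_key)

text \<open>Let \<open>t\<close> be the normal form of \<open>val (u @ v)\<close>. Inserting
  \<open>x\<close> into \<open>u @ v\<close> restores the given normal form by sortedness, and
  inserting it into \<open>t\<close> gives a word of the same value. As insertion preserves the
  shortlex order, \<open>t\<close> cannot be smaller than \<open>u @ v\<close>.\<close>

lemma least_delete:
  assumes w: "shortlex_least (u @ x # v)" and x: "x \<in> X"
  shows "shortlex_least (u @ v)"
proof -
  have uv: "u \<in> lists Z" "v \<in> lists Z" using w by (auto simp: shortlex_least_def)
  obtain t where t: "shortlex_least t" "val t = val (u @ v)"
    using least_ex[of "val (u @ v)"] uv by auto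
  have sorted: "sorted (map rank (u @ x # v))" using w by (rule least_sorted)
  have ins: "insort_key rank x (u @ v) = u @ x # v"
  proof (rule sorted_key_unique[of rank])
    show "sorted (map rank (insort_key rank x (u @ v)))"
      using sorted by (auto simp: sorted_insort_key sorted_append)
    show "inj_on rank (set (insort_key rank x (u @ v)))"
      using uv x by (intro inj_on_subset[OF rank_inj]) (auto simp: set_insort_key)
  qed (use sorted in auto)
  have val: "val (insort_key rank x t) = val (u @ x # v)"
    using val_insort[OF x, of "u @ v"] val_insort[OF x, of t] t uv ins by (simp add: shortlex_least_def)
  have not: "(insort_key rank x t, u @ x # v) \<notin> shortlex rank_order"
    using w val insort_lists[of x t] x t(1) unfolding shortlex_least_def by simp
  have len: "length t = length (u @ v)"
    using not t(1) uv t(2) least_geodesic[OF t(1)] unfolding geodesic_def shortlex_iff by force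
  have "(t, u @ v) \<notin> lex lt"
    using insort_key_lex[of t "u @ v" Z rank x] len ins x not by (auto simp: shortlex_iff)
  then have "(t, u @ v) \<notin> shortlex rank_order" using len by (simp add: shortlex_iff)
  then have "t = u @ v" using least_less[OF t(1), of "u @ v"] uv t(2) by auto
  then show ?thesis using t by simp
qed

lemma piecewise_testable_SL: "piecewise_testable Z (SL G Z rank_order)"
  unfolding SL_eq
proof (rule piecewise_testable_deletion_closed[of Z _ X 1])
  show "{w. shortlex_least w} \<subseteq> lists Z" by (auto simp: shortlex_least_def)
qed (use finite_Z least_delete least_outer in auto)

lemma regular_ConjMinLenSL: "regular_language Z (ConjMinLenSL G Z rank_order)"
  unfolding ConjMinLenSL_eq
  by (intro piecewise_testable_imp_regular piecewise_testable.inter piecewise_testable_SL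
      piecewise_testable_ConjGeo finite_Z)

end


section \<open>Multiplier automata\<close>

lemma length_padded_pair: "length (padded_pair u v) = max (length u) (length v)"
  by (induction u v rule: padded_pair.induct) auto

text \<open>The hypotheses express that padding occurs only at the end: a word that is padded in the
  first block must not continue in the second.\<close>

lemma padded_pair_append:
  assumes "length u1 < length v1 \<Longrightarrow> u2 = []" "length v1 < length u1 \<Longrightarrow> v2 = []"
  shows "padded_pair (u1 @ u2) (v1 @ v2) = padded_pair u1 v1 @ padded_pair u2 v2"
  using assms by (induction u1 v1 rule: padded_pair.induct) auto

lemma padded_pair_fst: "List.map_filter fst (padded_pair u v) = u"
  by (induction u v rule: padded_pair.induct) (auto simp: map_filter_simps)

lemma padded_pair_snd: "List.map_filter snd (padded_pair u v) = v"
  by (induction u v rule: padded_pair.induct) (auto simp: map_filter_simps)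

lemma padded_pair_inject: "padded_pair u v = padded_pair u' v' \<longleftrightarrow> u = u' \<and> v = v'"
  using padded_pair_fst padded_pair_snd by metis

lemma padded_pair_lists:
  "u \<in> lists A \<Longrightarrow> v \<in> lists A \<Longrightarrow> padded_pair u v \<in> lists (padded_alphabet A)"
  by (induction u v rule: padded_pair.induct) (auto simp: padded_alphabet_def)

lemma finite_padded_alphabet: "finite A \<Longrightarrow> finite (padded_alphabet A)"
  by (simp add: padded_alphabet_def)

lemma padded_pair_split:
  assumes "padded_pair u v = p @ q"
  obtains u1 u2 v1 v2 where "u = u1 @ u2" "v = v1 @ v2"
    "p = padded_pair u1 v1" "q = padded_pair u2 v2"
    "length u1 < length v1 \<Longrightarrow> u2 = []" "length v1 < length u1 \<Longrightarrow> v2 = []"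
proof
  let ?n = "length p"
  show u: "u = take ?n u @ drop ?n u" and v: "v = take ?n v @ drop ?n v" by simp_all
  show 1: "drop ?n u = []" if "length (take ?n u) < length (take ?n v)" using that by auto
  show 2: "drop ?n v = []" if "length (take ?n v) < length (take ?n u)" using that by auto
  have "padded_pair (take ?n u @ drop ?n u) (take ?n v @ drop ?n v) =
      padded_pair (take ?n u) (take ?n v) @ padded_pair (drop ?n u) (drop ?n v)"
    by (rule padded_pair_append) (fact 1, fact 2)
  then have "padded_pair (take ?n u) (take ?n v) @ padded_pair (drop ?n u) (drop ?n v) = p @ q"
    using assms by simp
  moreover have "?n \<le> max (length u) (length v)"
    using assms length_padded_pair[of u v] by simp
  then have "length (padded_pair (take ?n u) (take ?n v)) = ?n"
    by (auto simp: length_padded_pair)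
  ultimately show "p = padded_pair (take ?n u) (take ?n v)" "q = padded_pair (drop ?n u) (drop ?n v)"
    by (simp_all add: append_eq_append_conv)
qed

context split_generators
begin

text \<open>After the prefix \<open>padded_pair u1 v1\<close>, the possible continuations depend
  only on the quotients of \<open>L\<close> by \<open>u1\<close> and \<open>v1\<close>, the word
  difference, and which word has already ended. Prefixes without continuation have the empty
  quotient, so \<open>D\<close> need only cover pairs that can be completed.\<close>

lemma regular_multiplier:
  assumes L: "regular_language Z L" and c: "c \<in> carrier G" and "finite D"
    and D: "\<And>u1 u2 v1 v2. u1 @ u2 \<in> L \<Longrightarrow> v1 @ v2 \<in> L \<Longrightarrow>
      val (u1 @ u2) \<otimes> c = val (v1 @ v2) \<Longrightarrow> (length u1 < length v1 \<Longrightarrow> u2 = []) \<Longrightarrow>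
      (length v1 < length u1 \<Longrightarrow> v2 = []) \<Longrightarrow> inv (val u1) \<otimes> val v1 \<in> D"
  shows "regular_language (padded_alphabet Z)
    {padded_pair u v | u v. u \<in> L \<and> v \<in> L \<and> val u \<otimes> c = val v}" (is "regular_language _ ?R")
proof -
  have LZ: "L \<subseteq> lists Z" and fin: "finite (range (quot L))"
    using L by (simp_all add: myhill_nerode)
  \<comment> \<open>The quotient is recovered from these data; the flags \<open>f\<close> and
    \<open>g\<close> record that the first or the second word has ended.\<close>
  define F where "F = (\<lambda>(P, Q, d, f, g). {padded_pair u v | u v. u \<in> P \<and> v \<in> Q \<and>
     val u \<otimes> c = d \<otimes> val v \<and> (f \<longrightarrow> u = []) \<and> (g \<longrightarrow> v = [])})"
  define I where "I = range (quot L) \<times> range (quot L) \<times> D \<times> (UNIV :: bool set) \<times> (UNIV :: bool set)"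
  have "quot ?R p \<in> insert {} (F ` I)" for p
  proof (cases "quot ?R p = {}")
    case False
    then obtain q u v where "p @ q = padded_pair u v" "u \<in> L" "v \<in> L" "val u \<otimes> c = val v"
      unfolding quot_def by blast
    then obtain u1 u2 v1 v2 where p: "p = padded_pair u1 v1"
      and uv: "u1 @ u2 \<in> L" "v1 @ v2 \<in> L" "val (u1 @ u2) \<otimes> c = val (v1 @ v2)"
      and len: "length u1 < length v1 \<Longrightarrow> u2 = []" "length v1 < length u1 \<Longrightarrow> v2 = []"
      using padded_pair_split[of u v p q] by metis
    let ?d = "inv (val u1) \<otimes> val v1"
    have u1: "u1 \<in> lists Z" and v1: "v1 \<in> lists Z" using uv LZ by auto
    have key: "val (u1 @ u) \<otimes> c = val (v1 @ v) \<longleftrightarrow> val u \<otimes> c = ?d \<otimes> val v"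
      if "u \<in> lists Z" "v \<in> lists Z" for u v
      using that u1 v1 c by (auto simp: val_append m_assoc inv_solve_left)
    have "quot ?R p = F (quot L u1, quot L v1, ?d, length u1 < length v1, length v1 < length u1)"
    proof (intro Set.set_eqI iffI)
      fix q assume "q \<in> quot ?R p"
      then obtain u v where q: "padded_pair u v = p @ q" "u \<in> L" "v \<in> L" "val u \<otimes> c = val v"
        unfolding quot_def by auto
      obtain u1' u2 v1' v2 where s: "u = u1' @ u2" "v = v1' @ v2"
        "p = padded_pair u1' v1'" "q = padded_pair u2 v2"
        "length u1' < length v1' \<Longrightarrow> u2 = []" "length v1' < length u1' \<Longrightarrow> v2 = []"
        using padded_pair_split[OF q(1)] by metis
      then have "u1' = u1" "v1' = v1" using p by (simp_all add: padded_pair_inject)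
      moreover have "u2 \<in> lists Z" "v2 \<in> lists Z" using q(2,3) s(1,2) LZ by auto
      ultimately show "q \<in> F (quot L u1, quot L v1, ?d, length u1 < length v1, length v1 < length u1)"
        using s q key[of u2 v2] unfolding F_def quot_def by auto
    next
      fix q assume "q \<in> F (quot L u1, quot L v1, ?d, length u1 < length v1, length v1 < length u1)"
      then obtain u v where q: "q = padded_pair u v" "u1 @ u \<in> L" "v1 @ v \<in> L"
        "val u \<otimes> c = ?d \<otimes> val v"
        "length u1 < length v1 \<Longrightarrow> u = []" "length v1 < length u1 \<Longrightarrow> v = []"
        unfolding F_def quot_def by auto
      have "u \<in> lists Z" "v \<in> lists Z" using q(2,3) LZ by auto
      then have "val (u1 @ u) \<otimes> c = val (v1 @ v)" using key q(4) by blast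
      moreover have "p @ q = padded_pair (u1 @ u) (v1 @ v)"
        unfolding p q(1) using padded_pair_append[OF q(5,6)] by simp
      ultimately show "q \<in> quot ?R p" unfolding quot_def using q(2,3) by blast
    qed
    moreover have "?d \<in> D" using D[OF uv len] .
    ultimately show ?thesis unfolding I_def by blast
  qed simp
  then have "range (quot ?R) \<subseteq> insert {} (F ` I)" by blast
  moreover have "finite I" unfolding I_def using fin \<open>finite D\<close> by simp
  ultimately have "finite (range (quot ?R))" by (meson finite.insertI finite_imageI finite_subset)
  moreover have "?R \<subseteq> lists (padded_alphabet Z)"
  proof
    fix p assume "p \<in> ?R"
    then obtain u v where "p = padded_pair u v" "u \<in> L" "v \<in> L" by auto
    then show "p \<in> lists (padded_alphabet Z)"
      using padded_pair_lists subsetD[OF LZ] by metis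
  qed
  ultimately show ?thesis
    using finite_padded_alphabet[OF finite_Z] by (simp add: myhill_nerode)
qed

text \<open>The bound leaves finitely many projections, so Higman's lemma can be combined with
  equality of projections.\<close>

lemma wqo_same_outer:
  "wqo_set (\<lambda>m w. subseq m w \<and> outer m = outer w) {w \<in> lists Z. length (outer w) \<le> k}"
proof (rule wqo_set_conj)
  show "wqo_set subseq {w \<in> lists Z. length (outer w) \<le> k}"
    by (rule wqo_set_mono[OF higman[OF finite_Z]]) auto
  have "wqo_set (=) {s \<in> lists Z. length s \<le> k}"
    by (rule wqo_set_eq_finite[OF finite_lists_bounded_length[OF finite_Z]])
  then show "wqo_set (\<lambda>m w. outer m = outer w) {w \<in> lists Z. length (outer w) \<le> k}"
    by (rule wqo_set_vimage) auto
qed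

text \<open>Only the multiset of added letters is recorded; for sorted words it determines the
  extension.\<close>

lemma same_outer_extension:
  assumes "subseq m w" "outer m = outer w"
  obtains a where "a \<in> lists X" "mset w = mset m + mset a"
proof -
  have "mset m \<subseteq># mset w"
    using assms(1) by (induction rule: list_emb.induct) (auto simp: subset_mset.add_increasing2 intro: subset_mset.order_trans)
  obtain a where a: "mset a = mset w - mset m" using ex_mset by blast
  have "filter_mset (\<lambda>z. z \<notin> X) (mset a) = mset (outer w) - mset (outer m)"
    unfolding a by (simp add: mset_filter)
  then have "filter_mset (\<lambda>z. z \<notin> X) (mset a) = {#}" using assms(2) by simp
  then have "a \<in> lists X" by (auto simp: filter_mset_eq_mempty_iff)
  moreover have "mset w = mset m + mset a" unfolding a using \<open>mset m \<subseteq># mset w\<close> by simp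
  ultimately show thesis by (rule that)
qed

end

section \<open>Finiteness of word differences and the automatic structure\<close>

context ordered_split_generators
begin

text \<open>Realises multiplication by a word over \<open>X\<close> while keeping sorted words
  sorted.\<close>

abbreviation ins :: "'a list \<Rightarrow> 'a list \<Rightarrow> 'a list" where
  "ins \<equiv> foldr (insort_key rank)"

lemma ins_lists: "a \<in> lists Z \<Longrightarrow> w \<in> lists Z \<Longrightarrow> ins a w \<in> lists Z"
  by (induction a) (simp_all add: insort_lists)

lemma mset_ins: "mset (ins a w) = mset a + mset w"
  by (induction a) simp_all

lemma sorted_ins: "sorted (map rank w) \<Longrightarrow> sorted (map rank (ins a w))"
  by (induction a) (simp_all add: sorted_insort_key)

lemma val_ins: "a \<in> lists X \<Longrightarrow> w \<in> lists Z \<Longrightarrow> val (ins a w) = val a \<otimes> val w"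
proof (induction a)
  case (Cons x a)
  then have "x \<in> X" "a \<in> lists X" by auto
  then show ?case using Cons by (simp add: val_insort ins_lists m_assoc)
qed simp

lemma shortlex_ins:
  assumes "(u, v) \<in> shortlex rank_order" "a \<in> lists Z"
  shows "(ins a u, ins a v) \<in> shortlex rank_order"
  using assms(2)
proof (induction a)
  case (Cons x a)
  then have "(ins a u, ins a v) \<in> shortlex rank_order" "x \<in> Z" by auto
  then show ?case using insort_key_lex[of "ins a u" "ins a v" Z rank x] by (auto simp: shortlex_iff)
qed (use assms in simp)

lemma sorted_unique:
  assumes "sorted (map rank u)" "sorted (map rank v)" "mset u = mset v" "u \<in> lists Z"
  shows "u = v"
  using assms by (intro sorted_key_unique[of rank]) (auto intro: inj_on_subset[OF rank_inj])

text \<open>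
  The second solution arises from the first by inserting the letters of \<open>a1 @ a2\<close> and \<open>b1 @ b2\<close>,
  which have the same value. Sorted insertion is monotone for the shortlex order, so if these two
  multisets differed, exchanging them would make one of the normal forms smaller. Hence they agree,
  and since the words are sorted, \<open>a1\<close> and \<open>b1\<close> consist of equally many of the smallest letters.
\<close>

lemma word_difference_eq:
  assumes u: "shortlex_least (u1 @ u2)" and v: "shortlex_least (v1 @ v2)" and len: "length u1 = length v1"
    and eq: "val (u1 @ u2) \<otimes> c = val (v1 @ v2)"
    and u': "shortlex_least (u1' @ u2')" and v': "shortlex_least (v1' @ v2')" and len': "length u1' = length v1'"
    and eq': "val (u1' @ u2') \<otimes> c = val (v1' @ v2')"
    and c: "c \<in> carrier G"
    and a1: "a1 \<in> lists X" "mset u1' = mset u1 + mset a1"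
    and a2: "a2 \<in> lists X" "mset u2' = mset u2 + mset a2"
    and b1: "b1 \<in> lists X" "mset v1' = mset v1 + mset b1"
    and b2: "b2 \<in> lists X" "mset v2' = mset v2 + mset b2"
  shows "inv (val u1) \<otimes> val v1 = inv (val u1') \<otimes> val v1'"
proof -
  let ?u = "u1 @ u2" and ?v = "v1 @ v2" and ?u' = "u1' @ u2'" and ?v' = "v1' @ v2'"
  let ?a = "a1 @ a2" and ?b = "b1 @ b2"
  have Z: "?u \<in> lists Z" "?v \<in> lists Z" "?u' \<in> lists Z" "?v' \<in> lists Z"
    using u v u' v' by (simp_all add: shortlex_least_def)
  have ab: "?a \<in> lists X" "?b \<in> lists X" using a1 a2 b1 b2 by auto
  then have abZ: "?a \<in> lists Z" "?b \<in> lists Z" using lists_X_Z by blast+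
  have sorted: "sorted (map rank ?u)" "sorted (map rank ?v)" "sorted (map rank ?u')" "sorted (map rank ?v')"
    using u v u' v' least_sorted by blast+
  have u'_eq: "ins ?a ?u = ?u'"
    by (rule sorted_unique) (use sorted sorted_ins Z abZ ins_lists a1 a2 in \<open>auto simp: mset_ins\<close>)
  have v'_eq: "ins ?b ?v = ?v'"
    by (rule sorted_unique) (use sorted sorted_ins Z abZ ins_lists b1 b2 in \<open>auto simp: mset_ins\<close>)
  \<comment> \<open>The second equation is the first one with \<open>val ?a\<close> and
    \<open>val ?b\<close> multiplied in from the left; \<open>val ?v\<close> then cancels.\<close>
  have val_ab: "val ?a = val ?b"
  proof -
    have "val ?a \<otimes> val ?v = val ?a \<otimes> val ?u \<otimes> c" using Z abZ c eq[symmetric] by (simp add: m_assoc)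
    also have "\<dots> = val ?v'" using val_ins[OF ab(1) Z(1)] u'_eq eq' by simp
    also have "\<dots> = val ?b \<otimes> val ?v" using val_ins[OF ab(2) Z(2)] v'_eq by simp
    finally show ?thesis using Z abZ by (meson right_cancel val_closed)
  qed
  \<comment> \<open>The roles of inserted letters and receiving word can be exchanged. This lets
    \<open>shortlex_ins\<close> carry a comparison of the sorted forms of \<open>?a\<close> and
    \<open>?b\<close> over to \<open>?v\<close> or \<open>?u\<close>.\<close>
  have comm: "ins w (ins s []) = ins s w" if "sorted (map rank w)" "w \<in> lists Z" "s \<in> lists Z" for w s
    by (rule sorted_unique) (use that sorted_ins ins_lists in \<open>auto simp: mset_ins\<close>)
  have "ins ?a [] = ins ?b []"
  proof (rule ccontr)
    assume "ins ?a [] \<noteq> ins ?b []"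
    moreover have "ins ?a [] \<in> lists Z" "ins ?b [] \<in> lists Z" using abZ ins_lists by blast+
    ultimately consider "(ins ?a [], ins ?b []) \<in> shortlex rank_order" | "(ins ?b [], ins ?a []) \<in> shortlex rank_order"
      using shortlex_total by blast
    then show False
    proof cases
      case 1
      then have "(ins ?a ?v, ins ?b ?v) \<in> shortlex rank_order"
        using shortlex_ins[OF 1 Z(2)] comm[OF sorted(2) Z(2) abZ(1)] comm[OF sorted(2) Z(2) abZ(2)]
        by (simp only:)
      moreover have "val (ins ?a ?v) = val (ins ?b ?v)"
        unfolding val_ins[OF ab(1) Z(2)] val_ins[OF ab(2) Z(2)] val_ab ..
      ultimately show False
        using v' ins_lists[OF abZ(1) Z(2)] unfolding v'_eq shortlex_least_def by blast
    next
      case 2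
      then have "(ins ?b ?u, ins ?a ?u) \<in> shortlex rank_order"
        using shortlex_ins[OF 2 Z(1)] comm[OF sorted(1) Z(1) abZ(1)] comm[OF sorted(1) Z(1) abZ(2)]
        by (simp only:)
      moreover have "val (ins ?b ?u) = val (ins ?a ?u)"
        unfolding val_ins[OF ab(1) Z(1)] val_ins[OF ab(2) Z(1)] val_ab ..
      ultimately show False
        using u' ins_lists[OF abZ(2) Z(1)] unfolding u'_eq shortlex_least_def by blast
    qed
  qed
  then have mset: "mset ?a = mset ?b" using mset_ins[of ?a "[]"] mset_ins[of ?b "[]"] by simp
  \<comment> \<open>In a sorted word no letter of \<open>w1\<close> ranks above one of
    \<open>w2\<close>, so the separately sorted parts \<open>s1\<close> and \<open>s2\<close>
    concatenate to a sorted word.\<close>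
  have split: "sorted (map rank (ins s1 [] @ ins s2 []))"
    if "sorted (map rank (w1 @ w2))" "set s1 \<subseteq> set w1" "set s2 \<subseteq> set w2" for s1 s2 w1 w2
  proof -
    have "set (ins s []) = set s" for s using mset_ins[of s "[]"] by (metis add.right_neutral mset.simps(1) set_mset_mset)
    then show ?thesis using that sorted_ins[of "[]"] by (auto simp: sorted_append subset_iff)
  qed
  have sub: "set s \<subseteq> set w'" if "mset w' = mset w + mset s" for s w w' :: "'a list"
    using that by (metis mset_subset_eq_add_right set_mset_mono set_mset_mset)
  have "ins a1 [] @ ins a2 [] = ins b1 [] @ ins b2 []"
  proof (rule sorted_unique)
    show "sorted (map rank (ins a1 [] @ ins a2 []))"
      using split[OF sorted(3) sub[OF a1(2)] sub[OF a2(2)]] .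
    show "sorted (map rank (ins b1 [] @ ins b2 []))"
      using split[OF sorted(4) sub[OF b1(2)] sub[OF b2(2)]] .
    show "mset (ins a1 [] @ ins a2 []) = mset (ins b1 [] @ ins b2 [])"
      using mset by (simp add: mset_ins)
    show "ins a1 [] @ ins a2 [] \<in> lists Z"
      using ins_lists abZ by simp
  qed
  moreover have "length (ins a1 []) = length (ins b1 [])"
  proof -
    have "length u1' = length u1 + length a1" "length v1' = length v1 + length b1"
      using a1(2) b1(2) by (metis size_mset size_union)+
    then have "length a1 = length b1" using len len' by simp
    then show ?thesis using mset_ins[of a1 "[]"] mset_ins[of b1 "[]"]
      by (metis size_mset size_union mset.simps(1) add.right_neutral)
  qed
  ultimately have "ins a1 [] = ins b1 []" by (simp add: append_eq_append_conv)
  then have val1: "val a1 = val b1"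
    using val_ins[OF a1(1), of "[]"] val_ins[OF b1(1), of "[]"] a1(1) b1(1) by simp
  have Z1: "u1 \<in> lists Z" "v1 \<in> lists Z" "a1 \<in> lists Z" "b1 \<in> lists Z"
    using Z a1 b1 lists_X_Z by auto
  \<comment> \<open>Both prefixes are multiplied from the left by the same element
    \<open>val a1\<close>, which cancels in the word difference.\<close>
  have "ins a1 u1 = u1'"
    by (rule sorted_unique) (use sorted sorted_ins Z1 ins_lists a1 in \<open>auto simp: mset_ins sorted_append\<close>)
  then have "val u1' = val a1 \<otimes> val u1" using val_ins[OF a1(1) Z1(1)] by simp
  moreover have "ins b1 v1 = v1'"
    by (rule sorted_unique) (use sorted sorted_ins Z1 ins_lists b1 in \<open>auto simp: mset_ins sorted_append\<close>)
  then have "val v1' = val a1 \<otimes> val v1" using val_ins[OF b1(1) Z1(2)] val1 by simp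
  ultimately show ?thesis using Z1 by (simp add: inv_mult_group m_assoc)
qed

text \<open>Infinitely many differences would give an injective sequence \<open>e\<close>. Applying
  the well-quasi-order to the four words at once yields indices \<open>i < j\<close> to which
  \<open>word_difference_eq\<close> applies, whence \<open>e i = e j\<close>.\<close>

lemma finite_word_differences:
  assumes c: "c \<in> carrier G"
  shows "finite {inv (val u1) \<otimes> val v1 | u1 u2 v1 v2. shortlex_least (u1 @ u2) \<and> shortlex_least (v1 @ v2) \<and>
    length u1 = length v1 \<and> val (u1 @ u2) \<otimes> c = val (v1 @ v2)}" (is "finite ?E")
proof (rule ccontr)
  assume "infinite ?E"
  from infinite_countable_subset[OF this] obtain e :: "nat \<Rightarrow> 'a" where
    e: "inj e" "range e \<subseteq> ?E" by blast
  have "e n \<in> ?E" for n using e(2) by (rule subsetD) simp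
  then have "\<forall>n. \<exists>u1 u2 v1 v2. e n = inv (val u1) \<otimes> val v1 \<and> shortlex_least (u1 @ u2) \<and>
      shortlex_least (v1 @ v2) \<and> length u1 = length v1 \<and> val (u1 @ u2) \<otimes> c = val (v1 @ v2)"
    by simp
  then obtain u1 u2 v1 v2 where q: "\<And>n. e n = inv (val (u1 n)) \<otimes> val (v1 n)"
    "\<And>n. shortlex_least (u1 n @ u2 n)" "\<And>n. shortlex_least (v1 n @ v2 n)"
    "\<And>n. length (u1 n) = length (v1 n)" "\<And>n. val (u1 n @ u2 n) \<otimes> c = val (v1 n @ v2 n)"
    by metis
  let ?P = "\<lambda>m w. subseq m w \<and> outer m = outer w"
  let ?W = "{w \<in> lists Z. length (outer w) \<le> 1}"
  have component: "wqo_set (\<lambda>i j. ?P (s i) (s j)) UNIV" if "\<And>n. s n \<in> ?W" for s :: "nat \<Rightarrow> 'a list"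
    by (rule wqo_set_vimage[OF wqo_same_outer]) (rule that)
  have part: "u \<in> ?W" "v \<in> ?W" if "shortlex_least (u @ v)" for u v
    using least_outer[OF that] that by (auto simp: shortlex_least_def)
  have "wqo_set (\<lambda>i j. (?P (u1 i) (u1 j) \<and> ?P (u2 i) (u2 j)) \<and> (?P (v1 i) (v1 j) \<and> ?P (v2 i) (v2 j))) UNIV"
    by (rule wqo_set_conj[OF wqo_set_conj wqo_set_conj]; rule component)
      (rule part[OF q(2)] part[OF q(3)])+
  from wqo_setD[OF this, of "\<lambda>n. n"] obtain \<phi> :: "nat \<Rightarrow> nat" where \<phi>: "strict_mono \<phi>"
    "\<And>i j. i < j \<Longrightarrow> (?P (u1 (\<phi> i)) (u1 (\<phi> j)) \<and> ?P (u2 (\<phi> i)) (u2 (\<phi> j))) \<and>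
      (?P (v1 (\<phi> i)) (v1 (\<phi> j)) \<and> ?P (v2 (\<phi> i)) (v2 (\<phi> j)))"
    by auto
  define i j where "i = \<phi> 0" and "j = \<phi> 1"
  have "i < j" using \<phi>(1) by (simp add: i_def j_def strict_mono_less)
  have P: "?P (u1 i) (u1 j)" "?P (u2 i) (u2 j)" "?P (v1 i) (v1 j)" "?P (v2 i) (v2 j)"
    using \<phi>(2)[of 0 1] by (simp_all add: i_def j_def)
  obtain a1 where a1: "a1 \<in> lists X" "mset (u1 j) = mset (u1 i) + mset a1"
    using same_outer_extension P(1) by blast
  obtain a2 where a2: "a2 \<in> lists X" "mset (u2 j) = mset (u2 i) + mset a2"
    using same_outer_extension P(2) by blast
  obtain b1 where b1: "b1 \<in> lists X" "mset (v1 j) = mset (v1 i) + mset b1"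
    using same_outer_extension P(3) by blast
  obtain b2 where b2: "b2 \<in> lists X" "mset (v2 j) = mset (v2 i) + mset b2"
    using same_outer_extension P(4) by blast
  have "e i = e j"
    unfolding q(1) by (rule word_difference_eq[OF q(2,3,4,5) q(2,3,4,5) c a1 a2 b1 b2])
  then show False using \<open>i < j\<close> injD[OF e(1)] by blast
qed

text \<open>Normal forms are geodesic, and a generator changes the length by at most one. Hence
  padding can occur only in the last position.\<close>

lemma least_length_le:
  assumes u: "shortlex_least u" and v: "shortlex_least v" and c: "c \<in> insert \<one> Z" and eq: "val u \<otimes> c = val v"
  shows "length u \<le> Suc (length v)" "length v \<le> Suc (length u)"
proof -
  have uv: "u \<in> lists Z" "v \<in> lists Z" using u v by (simp_all add: shortlex_least_def)
  have step: "length s \<le> Suc (length t)"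
    if s: "shortlex_least s" and t: "t \<in> lists Z" and d: "d \<in> insert \<one> Z" and sd: "val s = val t \<otimes> d" for s t d
  proof (cases "d \<in> Z")
    case True
    then have "val (t @ [d]) = val s" "t @ [d] \<in> lists Z" using t sd by (simp_all add: val_append)
    then show ?thesis using least_geodesic[OF s] unfolding geodesic_def by fastforce
  next
    case False
    then have "val t = val s" using d sd t by simp
    then show ?thesis using least_geodesic[OF s] t unfolding geodesic_def by fastforce
  qed
  show "length v \<le> Suc (length u)" using step[OF v uv(1) c] eq by simp
  have "c \<in> carrier G" using c by auto
  then have "val u = val v \<otimes> inv c" using eq uv by (simp add: inv_solve_right)
  moreover have "inv c \<in> insert \<one> Z" using c Z_inv by auto
  ultimately show "length u \<le> Suc (length v)" using step[OF u uv(2)] by simp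
qed

lemma shortlex_automatic_rank_order: "shortlex_automatic G Z rank_order"
  unfolding shortlex_automatic_def automatic_structure_language_def
proof (intro conjI ballI)
  show reg: "regular_language Z (SL G Z rank_order)"
    by (rule piecewise_testable_imp_regular[OF piecewise_testable_SL finite_Z])
  show "val ` SL G Z rank_order = carrier G"
  proof
    show "val ` SL G Z rank_order \<subseteq> carrier G"
      by (simp add: SL_eq shortlex_least_def image_subset_iff)
    show "carrier G \<subseteq> val ` SL G Z rank_order"
    proof
      fix g assume "g \<in> carrier G"
      then obtain w where "shortlex_least w" "val w = g" using least_ex by blast
      then show "g \<in> val ` SL G Z rank_order" by (auto simp: SL_eq)
    qed
  qed
  fix c assume c: "c \<in> insert \<one> Z"
  then have cc: "c \<in> carrier G" by auto
  let ?E = "{inv (val u1) \<otimes> val v1 | u1 u2 v1 v2. shortlex_least (u1 @ u2) \<and> shortlex_least (v1 @ v2) \<and>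
    length u1 = length v1 \<and> val (u1 @ u2) \<otimes> c = val (v1 @ v2)}"
  show "regular_language (padded_alphabet Z)
      {padded_pair u v | u v. u \<in> SL G Z rank_order \<and> v \<in> SL G Z rank_order \<and> val u \<otimes> c = val v}"
  \<comment> \<open>The element \<open>c\<close> covers prefixes of unequal length: there both words
    are already complete, and their difference is \<open>c\<close>.\<close>
  proof (rule regular_multiplier[OF reg cc, of "insert c ?E"])
    show "finite (insert c ?E)" using finite_word_differences[OF cc] by simp
    fix u1 u2 v1 v2
    assume "u1 @ u2 \<in> SL G Z rank_order" "v1 @ v2 \<in> SL G Z rank_order"
      and eq: "val (u1 @ u2) \<otimes> c = val (v1 @ v2)"
      and len: "length u1 < length v1 \<Longrightarrow> u2 = []" "length v1 < length u1 \<Longrightarrow> v2 = []"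
    then have uv: "shortlex_least (u1 @ u2)" "shortlex_least (v1 @ v2)" by (simp_all add: SL_eq)
    show "inv (val u1) \<otimes> val v1 \<in> insert c ?E"
    proof (cases "length u1 = length v1")
      case True
      then show ?thesis using uv eq by blast
    next
      case False
      then have "u2 = [] \<and> v2 = []"
        using len least_length_le[OF uv c eq]
        by (cases "length u1 < length v1") (auto simp flip: length_0_conv)
      moreover have "u1 \<in> lists Z" using uv by (simp add: shortlex_least_def)
      ultimately show ?thesis using eq[symmetric] cc by simp
    qed
  qed
qed

end


section \<open>Virtually abelian groups\<close>

context group
begin

definition conj_class :: "'a \<Rightarrow> 'a set" where
  "conj_class a = (\<lambda>g. g \<otimes> a \<otimes> inv g) ` carrier G"

lemma conj_class_self: "a \<in> carrier G \<Longrightarrow> a \<in> conj_class a"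
  unfolding conj_class_def by (rule image_eqI[of _ _ \<one>]) auto

lemma conj_class_conj:
  assumes "a \<in> carrier G" "x \<in> conj_class a" "g \<in> carrier G"
  shows "g \<otimes> x \<otimes> inv g \<in> conj_class a"
proof -
  obtain k where k: "k \<in> carrier G" "x = k \<otimes> a \<otimes> inv k" using assms(2) by (auto simp: conj_class_def)
  then have "g \<otimes> x \<otimes> inv g = (g \<otimes> k) \<otimes> a \<otimes> inv (g \<otimes> k)"
    using assms by (simp add: m_assoc inv_mult_group)
  then show ?thesis using k assms(3) unfolding conj_class_def by blast
qed

lemma conj_class_inv:
  assumes "a \<in> carrier G" "x \<in> conj_class a"
  shows "inv x \<in> conj_class (inv a)"
proof -
  obtain k where k: "k \<in> carrier G" "x = k \<otimes> a \<otimes> inv k" using assms(2) by (auto simp: conj_class_def)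
  then have "inv x = k \<otimes> inv a \<otimes> inv k"
    using assms by (simp add: m_assoc inv_mult_group)
  then show ?thesis using k unfolding conj_class_def by blast
qed

end

text \<open>
  \<open>N\<close> is the normal core of the given abelian subgroup, that is, the kernel of the action on the
  right cosets; \<open>T\<close> picks one group element for every permutation of the cosets that occurs.
\<close>

lemma virtually_abelian_normal_core:
  fixes G :: "('a, 'b) monoid_scheme" (structure)
  assumes "group G" "virtually_abelian G"
  obtains N T where "N \<subseteq> carrier G" "\<And>a b. a \<in> N \<Longrightarrow> b \<in> N \<Longrightarrow> a \<otimes> b = b \<otimes> a"
    "\<And>a g. a \<in> N \<Longrightarrow> g \<in> carrier G \<Longrightarrow> g \<otimes> a \<otimes> inv g \<in> N"
    "\<And>a. a \<in> N \<Longrightarrow> inv a \<in> N"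
    "finite T" "T \<subseteq> carrier G" "\<And>g. g \<in> carrier G \<Longrightarrow> \<exists>t\<in>T. g \<otimes> inv t \<in> N"
proof -
  interpret group G by fact
  obtain H where H: "subgroup H G" "finite (rcosets H)" "comm_group (G\<lparr>carrier := H\<rparr>)"
    using assms(2) unfolding virtually_abelian_def by blast
  interpret H: subgroup H G by fact
  interpret HG: comm_group "G\<lparr>carrier := H\<rparr>" by fact
  define N where "N = {a \<in> carrier G. \<forall>k\<in>carrier G. k \<otimes> a \<otimes> inv k \<in> H}"
  \<comment> \<open>Restricting the action to the cosets makes it an element of an extensional
    function space, which is finite.\<close>
  define act where "act g = restrict (\<lambda>C. C #> g) (rcosets H)" for g
  define T where "T = inv_into (carrier G) act ` act ` carrier G"
  have N_H: "a \<in> H" if "a \<in> N" for a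
  proof -
    have "\<one> \<otimes> a \<otimes> inv \<one> \<in> H" "a \<in> carrier G" using that unfolding N_def by blast+
    then show ?thesis by simp
  qed
  show thesis
  proof
    show "N \<subseteq> carrier G" by (auto simp: N_def)
    show "a \<otimes> b = b \<otimes> a" if "a \<in> N" "b \<in> N" for a b
      using HG.m_comm[of a b] N_H that by simp
    show "g \<otimes> a \<otimes> inv g \<in> N" if "a \<in> N" "g \<in> carrier G" for a g
    proof -
      have a: "a \<in> carrier G" using that by (simp add: N_def)
      have "k \<otimes> (g \<otimes> a \<otimes> inv g) \<otimes> inv k = (k \<otimes> g) \<otimes> a \<otimes> inv (k \<otimes> g)" if "k \<in> carrier G" for k
        using a that \<open>g \<in> carrier G\<close> by (simp add: m_assoc inv_mult_group)
      then show ?thesis using that a unfolding N_def by simp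
    qed
    show "inv a \<in> N" if "a \<in> N" for a
    proof -
      have a: "a \<in> carrier G" using that by (simp add: N_def)
      have "k \<otimes> inv a \<otimes> inv k = inv (k \<otimes> a \<otimes> inv k)" if "k \<in> carrier G" for k
        using a that by (simp add: m_assoc inv_mult_group)
      then show ?thesis using that a unfolding N_def by (simp add: H.m_inv_closed)
    qed
    have "act g \<in> rcosets H \<rightarrow>\<^sub>E rcosets H" if "g \<in> carrier G" for g
    proof -
      have "C #> g \<in> rcosets H" if C: "C \<in> rcosets H" for C
      proof -
        obtain k where "k \<in> carrier G" "C = H #> k" using C by (auto simp: RCOSETS_def)
        then have "C #> g = H #> (k \<otimes> g)" using \<open>g \<in> carrier G\<close> H.subset by (simp add: coset_mult_assoc)
        then show ?thesis using \<open>k \<in> carrier G\<close> \<open>g \<in> carrier G\<close> by (auto simp: RCOSETS_def)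
      qed
      then show ?thesis by (simp add: act_def)
    qed
    then have "act ` carrier G \<subseteq> rcosets H \<rightarrow>\<^sub>E rcosets H" by blast
    then show "finite T" unfolding T_def
      using H(2) by (meson finite_PiE finite_imageI finite_subset)
    show "T \<subseteq> carrier G" unfolding T_def by (auto intro: inv_into_into)
    show "\<exists>t\<in>T. g \<otimes> inv t \<in> N" if g: "g \<in> carrier G" for g
    proof
      let ?t = "inv_into (carrier G) act (act g)"
      show "?t \<in> T" using g by (auto simp: T_def)
      have t: "?t \<in> carrier G" "act ?t = act g"
        using g by (auto intro: inv_into_into f_inv_into_f)
      \<comment> \<open>Since \<open>g\<close> and \<open>?t\<close> act alike, they send the coset
        of \<open>k\<close> to the same coset.\<close>
      have "k \<otimes> (g \<otimes> inv ?t) \<otimes> inv k \<in> H" if k: "k \<in> carrier G" for k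
      proof -
        have "H #> k \<in> rcosets H" using k by (auto simp: RCOSETS_def)
        then have "H #> k #> ?t = H #> k #> g" using fun_cong[OF t(2), of "H #> k"] by (simp add: act_def)
        then have "H #> (k \<otimes> ?t) = H #> (k \<otimes> g)"
          using k g t(1) H.subset by (simp add: coset_mult_assoc)
        then have "k \<otimes> g \<in> H #> (k \<otimes> ?t)" using rcos_self[OF _ H(1), of "k \<otimes> g"] k g by simp
        then obtain h where h: "h \<in> H" "k \<otimes> g = h \<otimes> (k \<otimes> ?t)" by (auto simp: r_coset_def)
        then have "(k \<otimes> g) \<otimes> inv (k \<otimes> ?t) = h" using k t(1) H.subset by (simp add: inv_solve_right' subsetD)
        moreover have "(k \<otimes> g) \<otimes> inv (k \<otimes> ?t) = k \<otimes> (g \<otimes> inv ?t) \<otimes> inv k"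
          using k t(1) g by (simp add: m_assoc inv_mult_group)
        ultimately show ?thesis using h(1) by simp
      qed
      then show "g \<otimes> inv ?t \<in> N" using g t(1) by (simp add: N_def)
    qed
  qed
qed

text \<open>Write \<open>g\<close> as an element of \<open>N\<close> times some \<open>t\<close> in
  \<open>T\<close>. The factor from \<open>N\<close> commutes with the conjugate of \<open>a\<close>
  by \<open>t\<close>, so only the conjugates by \<open>T\<close> occur.\<close>

lemma finite_conj_class:
  fixes G :: "('a, 'b) monoid_scheme" (structure)
  assumes "group G" and N: "N \<subseteq> carrier G" "\<And>a b. a \<in> N \<Longrightarrow> b \<in> N \<Longrightarrow> a \<otimes> b = b \<otimes> a"
    "\<And>a g. a \<in> N \<Longrightarrow> g \<in> carrier G \<Longrightarrow> g \<otimes> a \<otimes> inv g \<in> N"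
    and T: "finite T" "T \<subseteq> carrier G" "\<And>g. g \<in> carrier G \<Longrightarrow> \<exists>t\<in>T. g \<otimes> inv t \<in> N"
    and a: "a \<in> N"
  shows "finite (group.conj_class G a)"
proof -
  interpret group G by fact
  have "conj_class a \<subseteq> (\<lambda>t. t \<otimes> a \<otimes> inv t) ` T"
  proof
    fix x assume "x \<in> conj_class a"
    then obtain g where g: "g \<in> carrier G" "x = g \<otimes> a \<otimes> inv g" by (auto simp: conj_class_def)
    then obtain t where t: "t \<in> T" "g \<otimes> inv t \<in> N" using T(3) by blast
    have car: "t \<in> carrier G" "a \<in> carrier G" using t T(2) a N(1) by auto
    let ?n = "g \<otimes> inv t" and ?b = "t \<otimes> a \<otimes> inv t"
    have "x = ?n \<otimes> ?b \<otimes> inv ?n"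
      using g car by (simp add: m_assoc inv_mult_group) (simp add: m_assoc[symmetric])
    also have "\<dots> = ?b \<otimes> ?n \<otimes> inv ?n" using N(2)[OF t(2) N(3)[OF a car(1)]] by simp
    also have "\<dots> = ?b" using g car by (simp add: m_assoc)
    finally show "x \<in> (\<lambda>t. t \<otimes> a \<otimes> inv t) ` T" using t(1) by blast
  qed
  then show ?thesis using T(1) finite_surj by blast
qed

lemma virtually_abelian_split_generators:
  fixes G :: "('a, 'b) monoid_scheme" (structure)
  assumes "group G" "finitely_generated G" "virtually_abelian G"
  obtains X Y where "split_generators G X Y (X \<union> Y)"
proof -
  interpret group G by fact
  obtain S where S: "finite S" "S \<subseteq> carrier G" "generate G S = carrier G"
    using assms(2) unfolding finitely_generated_def by blast
  obtain N T where N: "N \<subseteq> carrier G" "\<And>a b. a \<in> N \<Longrightarrow> b \<in> N \<Longrightarrow> a \<otimes> b = b \<otimes> a"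
      "\<And>a g. a \<in> N \<Longrightarrow> g \<in> carrier G \<Longrightarrow> g \<otimes> a \<otimes> inv g \<in> N" "\<And>a. a \<in> N \<Longrightarrow> inv a \<in> N"
    and T: "finite T" "T \<subseteq> carrier G" "\<And>g. g \<in> carrier G \<Longrightarrow> \<exists>t\<in>T. g \<otimes> inv t \<in> N"
    by (rule virtually_abelian_normal_core[OF assms(1,3)], rule that)
  define Y where "Y = (S \<union> T) \<union> m_inv G ` (S \<union> T)"
  \<comment> \<open>The correction factors in \<open>N\<close> between products of two or three
    letters of \<open>Y\<close> and representatives \<open>t\<close>. Closing them under inversion
    and conjugation gives \<open>X\<close>, which stays finite by
    \<open>finite_conj_class\<close>.\<close>
  define P where "P = N \<inter> ((\<lambda>(y, z, t). y \<otimes> z \<otimes> inv t) ` (Y \<times> Y \<times> T) \<union>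
    (\<lambda>(x, y, z, t). x \<otimes> y \<otimes> z \<otimes> inv t) ` (Y \<times> Y \<times> Y \<times> T))"
  define X where "X = (\<Union>a \<in> P \<union> m_inv G ` P. conj_class a)"
  have Y: "finite Y" "Y \<subseteq> carrier G" using S T by (auto simp: Y_def)
  have P: "finite P" "P \<subseteq> N" using Y(1) T(1) by (simp_all add: P_def)
  have P': "P \<union> m_inv G ` P \<subseteq> N" using P(2) N(4) by auto
  have X_N: "X \<subseteq> N"
    using P' N(3) unfolding X_def conj_class_def by blast
  have P_X: "P \<subseteq> X" unfolding X_def using P(2) N(1) conj_class_self by blast
  have factor: "\<exists>x\<in>X. \<exists>y\<in>Y. g = x \<otimes> y" if g: "g \<in> carrier G" "\<And>t. t \<in> T \<Longrightarrow> g \<otimes> inv t \<in> N \<Longrightarrow> g \<otimes> inv t \<in> P" for g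
  proof -
    obtain t where t: "t \<in> T" "g \<otimes> inv t \<in> N" using T(3) g(1) by blast
    then have "g \<otimes> inv t \<in> X" "t \<in> Y" "g = (g \<otimes> inv t) \<otimes> t"
      using g T(2) P_X by (auto simp: Y_def m_assoc)
    then show ?thesis by blast
  qed
  have "split_generators G X Y (X \<union> Y)"
  proof (intro split_generators.intro split_generators_axioms.intro)
    show "group G" by fact
    show "finite X" unfolding X_def
      using P(1) P' finite_conj_class[OF assms(1) N(1-3) T] by (intro finite_UN_I) auto
    show "finite Y" "Y \<subseteq> carrier G" by fact+
    show "X \<subseteq> carrier G" using X_N N(1) by blast
    show "x \<otimes> x' = x' \<otimes> x" if "x \<in> X" "x' \<in> X" for x x' using N(2) X_N that by blast
    show "g \<otimes> x \<otimes> inv g \<in> X" if x: "x \<in> X" and g: "g \<in> carrier G" for x g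
    proof -
      obtain a where a: "a \<in> P \<union> m_inv G ` P" "x \<in> conj_class a" using x unfolding X_def by blast
      then have "a \<in> carrier G" using P' N(1) by blast
      then show ?thesis using conj_class_conj a g unfolding X_def by blast
    qed
    show "inv x \<in> X" if x: "x \<in> X" for x
    proof -
      obtain a where a: "a \<in> P \<union> m_inv G ` P" "x \<in> conj_class a" using x unfolding X_def by blast
      then have "a \<in> carrier G" using P' N(1) by blast
      then have "inv x \<in> conj_class (inv a)" using conj_class_inv a(2) by blast
      moreover have "inv a \<in> P \<union> m_inv G ` P" using a(1) P(2) N(1) by (auto simp: subset_iff)
      ultimately show ?thesis unfolding X_def by blast
    qed
    show "inv y \<in> Y" if "y \<in> Y" for y
      using that S(2) T(2) by (auto simp: Y_def subset_iff)
    show "\<exists>x\<in>X. \<exists>y\<in>Y. y1 \<otimes> y2 = x \<otimes> y" if "y1 \<in> Y" "y2 \<in> Y" for y1 y2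
    proof (rule factor)
      show "y1 \<otimes> y2 \<in> carrier G" using that Y by auto
      show "y1 \<otimes> y2 \<otimes> inv t \<in> P" if t: "t \<in> T" "y1 \<otimes> y2 \<otimes> inv t \<in> N" for t
        unfolding P_def using t \<open>y1 \<in> Y\<close> \<open>y2 \<in> Y\<close> by force
    qed
    show "\<exists>x\<in>X. \<exists>y\<in>Y. y1 \<otimes> y2 \<otimes> y3 = x \<otimes> y" if "y1 \<in> Y" "y2 \<in> Y" "y3 \<in> Y" for y1 y2 y3
    proof (rule factor)
      show "y1 \<otimes> y2 \<otimes> y3 \<in> carrier G" using that Y by auto
      show "y1 \<otimes> y2 \<otimes> y3 \<otimes> inv t \<in> P" if t: "t \<in> T" "y1 \<otimes> y2 \<otimes> y3 \<otimes> inv t \<in> N" for t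
        unfolding P_def using t \<open>y1 \<in> Y\<close> \<open>y2 \<in> Y\<close> \<open>y3 \<in> Y\<close> by force
    qed
    have "X \<union> Y \<subseteq> carrier G" using X_N N(1) Y(2) by blast
    then have "generate G (X \<union> Y) \<subseteq> carrier G" by (rule generate_incl)
    moreover have "S \<subseteq> X \<union> Y" by (auto simp: Y_def)
    then have "generate G S \<subseteq> generate G (X \<union> Y)" by (rule mono_generate)
    ultimately show "generate G (X \<union> Y) = carrier G" using S(3) by blast
  qed simp
  then show thesis by (rule that)
qed

lemma rank_function:
  assumes "finite Z"
  obtains f :: "'a \<Rightarrow> nat" where "inj_on f Z"
    "\<And>x z. x \<in> X \<Longrightarrow> x \<in> Z \<Longrightarrow> z \<in> Z \<Longrightarrow> z \<notin> X \<Longrightarrow> f x < f z"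
proof -
  obtain h n where h: "inj_on h Z" "h ` Z = {i::nat. i < n}"
    using finite_imp_inj_to_nat_seg[OF assms] by metis
  show thesis
  proof
    \<comment> \<open>The letters are numbered below \<open>n\<close>; adding \<open>n\<close> moves
      those outside \<open>X\<close> behind all letters of \<open>X\<close>.\<close>
    let ?f = "\<lambda>z. if z \<in> X then h z else h z + n"
    have bound: "h z < n" if "z \<in> Z" for z using h(2) that by blast
    show "inj_on ?f Z"
    proof (rule inj_onI)
      fix a b assume "a \<in> Z" "b \<in> Z" "?f a = ?f b"
      then have "h a = h b" using bound[of a] bound[of b] by (auto split: if_splits)
      then show "a = b" using inj_onD[OF h(1)] \<open>a \<in> Z\<close> \<open>b \<in> Z\<close> by blast
    qed
    show "?f x < ?f z" if "x \<in> X" "x \<in> Z" "z \<in> Z" "z \<notin> X" for x z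
      using bound[of x] that by simp
  qed
qed

theorem proposition3p3:
  fixes G :: "('a, 'b) monoid_scheme"
  assumes "group G"
    and "finitely_generated G"
    and "virtually_abelian G"
  shows "\<exists>Z. finite_inverse_closed_generating_set G Z \<and>
             piecewise_testable Z (ConjGeo G Z) \<and>
             (\<exists>r. linear_order_on Z r \<and>
                  shortlex_automatic G Z r \<and>
                  regular_language Z (ConjMinLenSL G Z r))"
proof -
  obtain X Y where XY: "split_generators G X Y (X \<union> Y)"
    using virtually_abelian_split_generators[OF assms] .
  interpret split_generators G X Y "X \<union> Y" by (rule XY)
  obtain rank :: "'a \<Rightarrow> nat" where "inj_on rank (X \<union> Y)"
    "\<And>x z. x \<in> X \<Longrightarrow> x \<in> X \<union> Y \<Longrightarrow> z \<in> X \<union> Y \<Longrightarrow> z \<notin> X \<Longrightarrow> rank x < rank z"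
    by (rule rank_function[OF finite_Z, of X], rule that)
  then interpret ordered_split_generators G X Y "X \<union> Y" rank
    by unfold_locales auto
  have "finite_inverse_closed_generating_set G (X \<union> Y)"
    unfolding finite_inverse_closed_generating_set_def
    using finite_Z Z_carrier Z_inv generate_Z by blast
  then show ?thesis
    using piecewise_testable_ConjGeo linear_order_rank_order shortlex_automatic_rank_order regular_ConjMinLenSL
    by blast
qed

end
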